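(* Let $a\in C^\infty(\mathbb T;\mathbb R)$, let $a_0=\frac1{2\pi}\int_0^{2\pi}a(t)\,dt$, and let $L=\partial_t-a(t)\partial_x$ on $\mathbb T^2$. Assume that $a_0\in\mathbb R\setminus\mathbb Q$ has finite irrationality measure $\mu(a_0)$. Let $k>\mu(a_0)$, and suppose that $u\in\mathcal D'(\mathbb T^2)$ is a solution of $Lu=f$, with $f\in H^k(\mathbb T^2)$. Then $u\in C^m(\mathbb T^2)$, where $$m=\left\lceil\frac{k-\mu(a_0)+\frac12}{3}\right\rceil-1.$$
   Context: $\mathbb T=\mathbb R/2\pi\mathbb Z$, with variables $(t,x)\in\mathbb T^2$ and dual frequencies $(\tau,\xi)\in\mathbb Z^2$. $\mathcal D'(\mathbb T^2)$ is the space of distributions on $\mathbb T^2$. Fourier coefficients are $\widehat f(\tau,\xi)=\frac1{(2\pi)^2}\int_{\mathbb T^2}f(t,x)e^{-i(t\tau+x\xi)}\,dt\,dx$ (by duality for distributions). $\langle w\rangle=(1+|w|^2)^{1/2}$. For $s\in\mathbb R$, $H^s(\mathbb T^2)$ is the isotropic Sobolev space of $f\in\mathcal D'(\mathbb T^2)$ with $\sum_{(\tau,\xi)\in\mathbb Z^2}\langle(\tau,\xi)\rangle^{2s}|\widehat f(\tau,\xi)|^2<\infty$. The irrationality measure of $\alpha\in\mathbb R\setminus\mathbb Q$ is $\mu(\alpha)=\sup\{\nu>0:\ |\alpha-p/q|<q^{-\nu}\text{ for infinitely many }(p,q)\in\mathbb Z\times\mathbb N\}\in[2,\infty]$. *)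

theory Defs
  imports "HOL-Analysis.Analysis"
begin

text \<open>
  Functions on the torus \<open>\<real>/2\<pi>\<int>\<close> (resp. its square) are rendered as functions on \<open>real\<close>
  (resp. \<open>real \<times> real\<close>) that are \<open>2\<pi>\<close>-periodic (in each variable).
\<close>

definition smooth_circle :: "(real \<Rightarrow> real) \<Rightarrow> bool" where
  "smooth_circle a \<longleftrightarrow>
     (\<forall>t. a (t + 2 * pi) = a t) \<and> (\<forall>n. (deriv ^^ n) a differentiable_on UNIV)"

definition periodic2 :: "(real \<times> real \<Rightarrow> complex) \<Rightarrow> bool" where
  "periodic2 g \<longleftrightarrow> (\<forall>t x. g (t + 2 * pi, x) = g (t, x) \<and> g (t, x + 2 * pi) = g (t, x))"

definition partial_t :: "(real \<times> real \<Rightarrow> complex) \<Rightarrow> real \<times> real \<Rightarrow> complex" where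
  "partial_t g = (\<lambda>(t, x). vector_derivative (\<lambda>s. g (s, x)) (at t))"

definition partial_x :: "(real \<times> real \<Rightarrow> complex) \<Rightarrow> real \<times> real \<Rightarrow> complex" where
  "partial_x g = (\<lambda>(t, x). vector_derivative (\<lambda>y. g (t, y)) (at x))"

primrec C_diff :: "nat \<Rightarrow> (real \<times> real \<Rightarrow> complex) \<Rightarrow> bool" where
  "C_diff 0 g \<longleftrightarrow> continuous_on UNIV g"
| "C_diff (Suc m) g \<longleftrightarrow>
     continuous_on UNIV g \<and>
     (\<forall>t x. (\<lambda>s. g (s, x)) differentiable at t \<and> (\<lambda>y. g (t, y)) differentiable at x) \<and>
     C_diff m (partial_t g) \<and> C_diff m (partial_x g)"

definition Cm_torus :: "nat \<Rightarrow> (real \<times> real \<Rightarrow> complex) set" where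
  "Cm_torus m = {g. periodic2 g \<and> C_diff m g}"

definition test_fun :: "(real \<times> real \<Rightarrow> complex) set" where
  "test_fun = {\<phi>. periodic2 \<phi> \<and> (\<forall>m. C_diff m \<phi>)}"

definition test_seminorm :: "nat \<Rightarrow> (real \<times> real \<Rightarrow> complex) \<Rightarrow> real" where
  "test_seminorm N \<phi> =
     (\<Sum>i\<le>N. \<Sum>j\<le>N. SUP p. norm ((partial_t ^^ i) ((partial_x ^^ j) \<phi>) p))"

text \<open>
  A distribution is a linear functional on the test functions, continuous for the Frechet
  topology given by the seminorms above. HOL functions being total, it also has
  irrelevant values outside of \<open>test_fun\<close>; equality of distributions is therefore \<open>dist_eq\<close>.
\<close>

type_synonym functional = "(real \<times> real \<Rightarrow> complex) \<Rightarrow> complex"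

definition distribution :: "functional \<Rightarrow> bool" where
  "distribution u \<longleftrightarrow>
     (\<forall>\<phi>\<in>test_fun. \<forall>\<psi>\<in>test_fun. u (\<lambda>p. \<phi> p + \<psi> p) = u \<phi> + u \<psi>) \<and>
     (\<forall>c. \<forall>\<phi>\<in>test_fun. u (\<lambda>p. c * \<phi> p) = c * u \<phi>) \<and>
     (\<exists>C N. \<forall>\<phi>\<in>test_fun. cmod (u \<phi>) \<le> C * test_seminorm N \<phi>)"

definition dist_eq :: "functional \<Rightarrow> functional \<Rightarrow> bool" where
  "dist_eq u v \<longleftrightarrow> (\<forall>\<phi>\<in>test_fun. u \<phi> = v \<phi>)"

text \<open>
  A function is identified with the functional \<open>\<phi> \<mapsto> \<integral> g \<phi>\<close> for unnormalised Lebesgue measure on the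
  torus; the factor \<open>1 / (2 \<pi>)\<^sup>2\<close> is in \<open>fourier_coeff\<close>.
\<close>

definition dist_of_fun :: "(real \<times> real \<Rightarrow> complex) \<Rightarrow> functional" where
  "dist_of_fun g = (\<lambda>\<phi>. integral (cbox (0, 0) (2 * pi, 2 * pi)) (\<lambda>p. g p * \<phi> p))"

definition dist_in_Cm :: "nat \<Rightarrow> functional \<Rightarrow> bool" where
  "dist_in_Cm m u \<longleftrightarrow> (\<exists>g\<in>Cm_torus m. dist_eq u (dist_of_fun g))"

definition dist_partial_t :: "functional \<Rightarrow> functional" where
  "dist_partial_t u = (\<lambda>\<phi>. - u (partial_t \<phi>))"

definition dist_partial_x :: "functional \<Rightarrow> functional" where
  "dist_partial_x u = (\<lambda>\<phi>. - u (partial_x \<phi>))"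

definition dist_mult_t :: "(real \<Rightarrow> real) \<Rightarrow> functional \<Rightarrow> functional" where
  "dist_mult_t a u = (\<lambda>\<phi>. u (\<lambda>(t, x). of_real (a t) * \<phi> (t, x)))"

definition L_op :: "(real \<Rightarrow> real) \<Rightarrow> functional \<Rightarrow> functional" where
  "L_op a u = (\<lambda>\<phi>. dist_partial_t u \<phi> - dist_mult_t a (dist_partial_x u) \<phi>)"

definition fourier_coeff :: "functional \<Rightarrow> int \<Rightarrow> int \<Rightarrow> complex" where
  "fourier_coeff u \<tau> \<xi> =
     u (\<lambda>(t, x). exp (- \<i> * of_real (t * of_int \<tau> + x * of_int \<xi>))) / of_real ((2 * pi)\<^sup>2)"

definition japanese_bracket :: "'a::real_normed_vector \<Rightarrow> real" where
  "japanese_bracket w = sqrt (1 + (norm w)\<^sup>2)"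

definition sobolev :: "real \<Rightarrow> functional set" where
  "sobolev s = {f. distribution f \<and>
     (\<lambda>(\<tau>, \<xi>). japanese_bracket (real_of_int \<tau>, real_of_int \<xi>) powr (2 * s)
        * (cmod (fourier_coeff f \<tau> \<xi>))\<^sup>2) summable_on UNIV}"

text \<open>The supremum is taken in \<open>ereal\<close> since the irrationality measure may be infinite.\<close>

definition irrationality_measure :: "real \<Rightarrow> ereal" where
  "irrationality_measure \<alpha> = Sup {ereal \<nu> | \<nu>. \<nu> > 0 \<and>
     infinite {(p :: int, q :: nat). q > 0 \<and> \<bar>\<alpha> - of_int p / of_nat q\<bar> < of_nat q powr (- \<nu>)}}"

end

theory Submission
  imports Defs
begin

text \<open>
  For a frequency \<open>q = (\<tau>, \<xi>) \<noteq> 0\<close>, solving an ODE in \<open>t\<close> gives a smooth periodic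
  \<open>V q = E(t) e\<^bsup>i\<xi>x\<^esup>\<close> with \<open>(\<partial>\<^sub>t - a \<partial>\<^sub>x) V q = e\<^bsup>i(\<tau>t + \<xi>x)\<^esup>\<close>. The periodicity condition divides by
  \<open>1 - e\<^bsup>2\<pi>ia\<^sub>0\<xi>\<^esup>\<close>, whose size is controlled by the irrationality measure, so that \<open>|V q|\<close> is
  at most a constant times \<open>\<langle>q\<rangle>\<^bsup>\<nu> - 1\<^esup>\<close> for any \<open>\<nu> > \<mu>\<close>, and each derivative costs a factor \<open>\<langle>q\<rangle>\<close>.
  Duality replaces any normal form: \<open>V (-q)\<close> is a test function with
  \<open>u(e\<^bsub>-q\<^esub>) = - f(V (-q))\<close>, and expanding \<open>f\<close> and integrating by parts shows that \<open>u\<close> has the same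
  Fourier coefficients as \<open>\<Sum> c(q) V q\<close>, where \<open>c(q)\<close> are those of \<open>f\<close>, up to the zero mode. By Cauchy-Schwarz this series
  converges in \<open>C\<^sup>m\<close> as soon as \<open>m < k - \<mu>\<close>, which the given \<open>m\<close> satisfies.
\<close>

section \<open>Calculus of functions on the torus\<close>

text \<open>Since \<open>a\<close> does not depend on \<open>x\<close>, the operator is minus its
  own transpose. This is why one family \<open>V\<close> serves twice: as test functions probing
  \<open>u\<close>, and as the building blocks of the candidate solution. The exponents add up as
  follows. The small divisor costs \<open>\<nu> - 1\<close>, differentiation costs \<open>m\<close>,
  and passing from weighted square-summability to absolute summability over a two-dimensional
  lattice costs anything above 1; hence the condition \<open>\<nu> + m < k\<close>. Constants are
  annihilated by the operator. So the equation forces the mean of \<open>f\<close> to vanish and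
  leaves the mean of \<open>u\<close> free, and the zero mode of \<open>u\<close> is restored by an
  additive constant. The other obstacle is to upgrade equality of Fourier coefficients to equality
  of functionals, for which trigonometric polynomials must be dense for every seminorm and not only
  uniformly. This is obtained from the Stone-Weierstrass theorem by inverting a differential
  operator on trigonometric polynomials, so that no decay of Fourier coefficients of test functions
  has to be estimated.\<close>

lemma has_partial_t:
  assumes "C_diff (Suc m) g"
  shows "((\<lambda>s. g (s, x)) has_vector_derivative partial_t g (t, x)) (at t)"
  using assms by (auto simp: partial_t_def vector_derivative_works)

lemma has_partial_x:
  assumes "C_diff (Suc m) g"
  shows "((\<lambda>y. g (t, y)) has_vector_derivative partial_x g (t, x)) (at x)"
  using assms by (auto simp: partial_x_def vector_derivative_works)

lemma partial_t_eqI: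
  "(\<And>t x. ((\<lambda>s. g (s, x)) has_vector_derivative g' (t, x)) (at t)) \<Longrightarrow> partial_t g = g'"
  by (auto simp: partial_t_def vector_derivative_at fun_eq_iff)

lemma partial_x_eqI:
  "(\<And>t x. ((\<lambda>y. g (t, y)) has_vector_derivative g' (t, x)) (at x)) \<Longrightarrow> partial_x g = g'"
  by (auto simp: partial_x_def vector_derivative_at fun_eq_iff)

lemma C_diff_SucI:
  assumes "continuous_on UNIV g"
    and "\<And>t x. ((\<lambda>s. g (s, x)) has_vector_derivative g1 (t, x)) (at t)"
    and "\<And>t x. ((\<lambda>y. g (t, y)) has_vector_derivative g2 (t, x)) (at x)"
    and "C_diff m g1" "C_diff m g2"
  shows "C_diff (Suc m) g"
proof -
  have "partial_t g = g1" "partial_x g = g2"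
    by (rule partial_t_eqI partial_x_eqI, fact)+
  moreover have "(\<lambda>s. g (s, x)) differentiable at t" "(\<lambda>y. g (t, y)) differentiable at x" for t x
    using assms(2,3) by (blast intro: differentiableI_vector)+
  ultimately show ?thesis using assms(1,4,5) by simp
qed

lemma C_diff_imp_continuous: "C_diff m g \<Longrightarrow> continuous_on UNIV g"
  by (cases m) auto

lemma C_diff_add:
  "C_diff m f \<Longrightarrow> C_diff m g \<Longrightarrow> C_diff m (\<lambda>p. f p + g p)"
proof (induction m arbitrary: f g)
  case 0
  then show ?case by (auto intro!: continuous_intros)
next
  case (Suc m)
  note f = has_partial_t[OF Suc.prems(1)] has_partial_x[OF Suc.prems(1)]
  note g = has_partial_t[OF Suc.prems(2)] has_partial_x[OF Suc.prems(2)]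
  show ?case
  proof (rule C_diff_SucI)
    show "continuous_on UNIV (\<lambda>p. f p + g p)"
      using Suc.prems by (auto intro!: continuous_intros)
    show "C_diff m (\<lambda>p. partial_t f p + partial_t g p)" "C_diff m (\<lambda>p. partial_x f p + partial_x g p)"
      using Suc by auto
  qed (auto intro!: has_vector_derivative_add f g)
qed

lemma C_diff_cmult:
  "C_diff m f \<Longrightarrow> C_diff m (\<lambda>p. c * f p)"
proof (induction m arbitrary: f)
  case 0
  then show ?case by (auto intro!: continuous_intros)
next
  case (Suc m)
  note f = has_partial_t[OF Suc.prems(1)] has_partial_x[OF Suc.prems(1)]
  show ?case
  proof (rule C_diff_SucI)
    show "continuous_on UNIV (\<lambda>p. c * f p)"
      using Suc.prems by (auto intro!: continuous_intros)
    show "C_diff m (\<lambda>p. c * partial_t f p)" "C_diff m (\<lambda>p. c * partial_x f p)"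
      using Suc by auto
  qed (auto intro!: has_vector_derivative_mult_right f)
qed

section \<open>Reduction of periodic functions to a compact period square\<close>

lemma periodic2_shift:
  assumes "periodic2 g"
  shows "g (t + 2 * pi * of_int i, x + 2 * pi * of_int j) = g (t, x)"
proof -
  have t: "g (t + 2 * pi, x) = g (t, x)" and x: "g (t, x + 2 * pi) = g (t, x)" for t x
    using assms by (auto simp: periodic2_def)
  have "g (t + 2 * pi * of_int i, x) = g (t, x)" for t x
  proof (induction i rule: int_induct[where k = 0])
    case (step1 i)
    then show ?case using t[of "t + 2 * pi * of_int i" x] by (simp add: algebra_simps)
  next
    case (step2 i)
    then show ?case using t[of "t + 2 * pi * of_int (i - 1)" x] by (simp add: algebra_simps)
  qed auto
  moreover have "g (t, x + 2 * pi * of_int j) = g (t, x)" for t x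
  proof (induction j rule: int_induct[where k = 0])
    case (step1 i)
    then show ?case using x[of t "x + 2 * pi * of_int i"] by (simp add: algebra_simps)
  next
    case (step2 i)
    then show ?case using x[of t "x + 2 * pi * of_int (i - 1)"] by (simp add: algebra_simps)
  qed auto
  ultimately show ?thesis by simp
qed

lemma periodic_rep:
  fixes t :: real
  obtains i :: int and s where "t = s + 2 * pi * of_int i" "s \<in> {0..2 * pi}"
proof
  let ?i = "\<lfloor>t / (2 * pi)\<rfloor>"
  have "of_int ?i * (2 * pi) \<le> t" "t < (of_int ?i + 1) * (2 * pi)"
    using floor_divide_lower[of "2 * pi" t] floor_divide_upper[of "2 * pi" t] by auto
  then show "t - 2 * pi * of_int ?i \<in> {0..2 * pi}"
    by (auto simp: algebra_simps)
qed auto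

lemma periodic2_rep:
  assumes "periodic2 g"
  shows "\<exists>q \<in> cbox (0, 0) (2 * pi, 2 * pi). g p = g q"
proof -
  obtain t x where p: "p = (t, x)" by force
  obtain i s where s: "t = s + 2 * pi * of_int i" "s \<in> {0..2 * pi}" by (rule periodic_rep)
  obtain j y where y: "x = y + 2 * pi * of_int j" "y \<in> {0..2 * pi}" by (rule periodic_rep)
  have "(s, y) \<in> cbox (0, 0) (2 * pi, 2 * pi)" using s y by (auto simp: cbox_Pair_eq)
  then show ?thesis using periodic2_shift[OF assms, of s i y j] s y p by auto
qed

text \<open>A compact period square already contains all values. The maximum point itself, not only
  boundedness, is used in the critical point argument for derivatives.\<close>

lemma periodic2_attains_max:
  assumes "periodic2 g" "continuous_on UNIV g"
  obtains p where "\<And>q. norm (g q) \<le> norm (g p)"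
proof -
  let ?K = "cbox (0 :: real, 0 :: real) (2 * pi, 2 * pi)"
  have "(0, 0) \<in> ?K" by (auto simp: cbox_Pair_eq)
  then have "?K \<noteq> {}" by blast
  then obtain p where p: "p \<in> ?K" "\<And>q. q \<in> ?K \<Longrightarrow> norm (g q) \<le> norm (g p)"
    using continuous_attains_sup[of ?K "\<lambda>p. norm (g p)", OF compact_cbox] 
      continuous_on_norm[OF continuous_on_subset[OF assms(2)], of ?K] by blast
  have "norm (g q) \<le> norm (g p)" for q
    using periodic2_rep[OF assms(1), of q] p by auto
  with that show ?thesis by blast
qed

lemma periodic2_bdd:
  assumes "periodic2 g" "continuous_on UNIV g"
  shows "bdd_above (range (\<lambda>p. norm (g p)))"
  using periodic2_attains_max[OF assms] by (metis bdd_aboveI2)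

lemma has_vector_derivative_translate:
  fixes f :: "real \<Rightarrow> 'a::real_normed_vector"
  shows "(f has_vector_derivative D) (at (t + c)) \<longleftrightarrow>
    ((\<lambda>s. f (s + c)) has_vector_derivative D) (at t)"
proof -
  have *: "((\<lambda>s. f (s + c)) has_vector_derivative D) (at t)"
    if "(f has_vector_derivative D) (at (t + c))" for f :: "real \<Rightarrow> 'a" and t c
    using vector_diff_chain_at[of "\<lambda>s. s + c" 1 t f D] that
    by (simp add: o_def has_vector_derivative_add_const)
  show ?thesis
    using *[of f t c] *[of "\<lambda>s. f (s + c)" "t + c" "- c"] by auto
qed

text \<open>\<open>vector_derivative\<close> is a choice depending only on the predicate
  \<open>has_vector_derivative\<close>, which is invariant under translation; hence
  differentiability is not assumed.\<close>

lemma periodic2_partial_t: "periodic2 g \<Longrightarrow> periodic2 (partial_t g)"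
proof -
  assume g: "periodic2 g"
  have "vector_derivative (\<lambda>s. g (s, x)) (at (t + 2 * pi)) = vector_derivative (\<lambda>s. g (s, x)) (at t)" for t x
    using g has_vector_derivative_translate[of "\<lambda>s. g (s, x)" _ t "2 * pi"]
    by (simp add: vector_derivative_def periodic2_def)
  then show ?thesis using g by (auto simp: periodic2_def partial_t_def)
qed

lemma periodic2_partial_x: "periodic2 g \<Longrightarrow> periodic2 (partial_x g)"
proof -
  assume g: "periodic2 g"
  have "vector_derivative (\<lambda>y. g (t, y)) (at (x + 2 * pi)) = vector_derivative (\<lambda>y. g (t, y)) (at x)" for t x
    using g has_vector_derivative_translate[of "\<lambda>y. g (t, y)" _ x "2 * pi"]
    by (simp add: vector_derivative_def periodic2_def)
  then show ?thesis using g by (auto simp: periodic2_def partial_x_def)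
qed

text \<open>
  All partial derivatives of \<open>g\<close> of order \<open>j \<le> n\<close> are continuous and bounded by \<open>M * \<Lambda> ^ j\<close>.
\<close>

primrec Cbound :: "nat \<Rightarrow> real \<Rightarrow> real \<Rightarrow> (real \<times> real \<Rightarrow> complex) \<Rightarrow> bool" where
  "Cbound 0 \<Lambda> M g \<longleftrightarrow> continuous_on UNIV g \<and> (\<forall>p. norm (g p) \<le> M)"
| "Cbound (Suc n) \<Lambda> M g \<longleftrightarrow>
     continuous_on UNIV g \<and> (\<forall>p. norm (g p) \<le> M) \<and>
     (\<exists>g1 g2. (\<forall>t x. ((\<lambda>s. g (s, x)) has_vector_derivative g1 (t, x)) (at t)) \<and>
       (\<forall>t x. ((\<lambda>y. g (t, y)) has_vector_derivative g2 (t, x)) (at x)) \<and>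
       Cbound n \<Lambda> (M * \<Lambda>) g1 \<and> Cbound n \<Lambda> (M * \<Lambda>) g2)"

lemma Cbound_SucI:
  assumes "continuous_on UNIV g" "\<And>p. norm (g p) \<le> M"
    and "\<And>t x. ((\<lambda>s. g (s, x)) has_vector_derivative g1 (t, x)) (at t)"
    and "\<And>t x. ((\<lambda>y. g (t, y)) has_vector_derivative g2 (t, x)) (at x)"
    and "Cbound n \<Lambda> (M * \<Lambda>) g1" "Cbound n \<Lambda> (M * \<Lambda>) g2"
  shows "Cbound (Suc n) \<Lambda> M g"
  unfolding Cbound.simps using assms by blast

lemma Cbound_SucE:
  assumes "Cbound (Suc n) \<Lambda> M g"
  obtains g1 g2 where "continuous_on UNIV g" "\<And>p. norm (g p) \<le> M"
    "\<And>t x. ((\<lambda>s. g (s, x)) has_vector_derivative g1 (t, x)) (at t)"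
    "\<And>t x. ((\<lambda>y. g (t, y)) has_vector_derivative g2 (t, x)) (at x)"
    "Cbound n \<Lambda> (M * \<Lambda>) g1" "Cbound n \<Lambda> (M * \<Lambda>) g2"
  using assms unfolding Cbound.simps by blast

lemma Cbound_0: "Cbound n \<Lambda> M g \<Longrightarrow> Cbound 0 \<Lambda> M g"
  by (cases n) auto

lemma Cbound_imp_C_diff: "Cbound n \<Lambda> M g \<Longrightarrow> C_diff n g"
proof (induction n arbitrary: M g)
  case (Suc n)
  then obtain g1 g2 where
    "\<And>t x. ((\<lambda>s. g (s, x)) has_vector_derivative g1 (t, x)) (at t)"
    "\<And>t x. ((\<lambda>y. g (t, y)) has_vector_derivative g2 (t, x)) (at x)"
    "Cbound n \<Lambda> (M * \<Lambda>) g1" "Cbound n \<Lambda> (M * \<Lambda>) g2" by auto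
  then show ?case using Suc by (intro C_diff_SucI[of g g1 g2]) auto
qed auto

lemma Cbound_mono:
  "Cbound n \<Lambda> M g \<Longrightarrow> M \<le> M' \<Longrightarrow> \<Lambda> \<ge> 0 \<Longrightarrow> Cbound n \<Lambda> M' g"
proof (induction n arbitrary: M M' g)
  case 0
  then show ?case by (auto intro: order_trans)
next
  case (Suc n)
  from Suc.prems obtain g1 g2 where g:
    "continuous_on UNIV g" "\<And>p. norm (g p) \<le> M"
    "\<And>t x. ((\<lambda>s. g (s, x)) has_vector_derivative g1 (t, x)) (at t)"
    "\<And>t x. ((\<lambda>y. g (t, y)) has_vector_derivative g2 (t, x)) (at x)"
    "Cbound n \<Lambda> (M * \<Lambda>) g1" "Cbound n \<Lambda> (M * \<Lambda>) g2" by auto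
  have "M * \<Lambda> \<le> M' * \<Lambda>" using Suc.prems by (intro mult_right_mono)
  then have "Cbound n \<Lambda> (M' * \<Lambda>) g1" "Cbound n \<Lambda> (M' * \<Lambda>) g2"
    using Suc.IH[OF g(5)] Suc.IH[OF g(6)] Suc.prems by auto
  with g Suc.prems(2) show ?case by (intro Cbound_SucI[of g M' g1 g2]) (auto intro: order_trans)
qed

lemma Cbound_lower: "Cbound (Suc n) \<Lambda> M g \<Longrightarrow> Cbound n \<Lambda> M g"
proof (induction n arbitrary: M g)
  case (Suc n)
  from Suc.prems obtain g1 g2 where
    "continuous_on UNIV g" "\<And>p. norm (g p) \<le> M"
    "\<And>t x. ((\<lambda>s. g (s, x)) has_vector_derivative g1 (t, x)) (at t)"
    "\<And>t x. ((\<lambda>y. g (t, y)) has_vector_derivative g2 (t, x)) (at x)"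
    "Cbound (Suc n) \<Lambda> (M * \<Lambda>) g1" "Cbound (Suc n) \<Lambda> (M * \<Lambda>) g2"
    by (rule Cbound_SucE) (rule that)
  with Suc.IH show ?case by (intro Cbound_SucI[of g M g1 g2])
qed auto

lemma Cbound_add:
  "Cbound n \<Lambda> M f \<Longrightarrow> Cbound n \<Lambda> M' g \<Longrightarrow> Cbound n \<Lambda> (M + M') (\<lambda>p. f p + g p)"
proof (induction n arbitrary: M M' f g)
  case 0
  then show ?case by (auto intro!: continuous_intros norm_triangle_mono)
next
  case (Suc n)
  from Suc.prems obtain f1 f2 g1 g2 where g:
    "\<And>t x. ((\<lambda>s. f (s, x)) has_vector_derivative f1 (t, x)) (at t)"
    "\<And>t x. ((\<lambda>y. f (t, y)) has_vector_derivative f2 (t, x)) (at x)"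
    "Cbound n \<Lambda> (M * \<Lambda>) f1" "Cbound n \<Lambda> (M * \<Lambda>) f2" 
    "\<And>t x. ((\<lambda>s. g (s, x)) has_vector_derivative g1 (t, x)) (at t)"
    "\<And>t x. ((\<lambda>y. g (t, y)) has_vector_derivative g2 (t, x)) (at x)"
    "Cbound n \<Lambda> (M' * \<Lambda>) g1" "Cbound n \<Lambda> (M' * \<Lambda>) g2" by auto
  have "Cbound n \<Lambda> ((M + M') * \<Lambda>) (\<lambda>p. f1 p + g1 p)" "Cbound n \<Lambda> ((M + M') * \<Lambda>) (\<lambda>p. f2 p + g2 p)"
    unfolding distrib_right using g Suc.IH by blast+
  moreover have "continuous_on UNIV (\<lambda>p. f p + g p)" "\<And>p. norm (f p + g p) \<le> M + M'"
    using Suc.prems by (auto intro!: continuous_intros norm_triangle_mono)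
  ultimately show ?case
    by (intro Cbound_SucI[where ?g1.0 = "\<lambda>p. f1 p + g1 p" and ?g2.0 = "\<lambda>p. f2 p + g2 p"])
       (auto intro!: has_vector_derivative_add g)
qed

lemma Cbound_cmult:
  "Cbound n \<Lambda> M g \<Longrightarrow> Cbound n \<Lambda> (norm c * M) (\<lambda>p. c * g p)"
proof (induction n arbitrary: M g)
  case 0
  then show ?case by (auto intro!: continuous_intros mult_left_mono simp: norm_mult)
next
  case (Suc n)
  from Suc.prems obtain g1 g2 where g:
    "\<And>t x. ((\<lambda>s. g (s, x)) has_vector_derivative g1 (t, x)) (at t)"
    "\<And>t x. ((\<lambda>y. g (t, y)) has_vector_derivative g2 (t, x)) (at x)"
    "Cbound n \<Lambda> (M * \<Lambda>) g1" "Cbound n \<Lambda> (M * \<Lambda>) g2" by auto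
  have "Cbound n \<Lambda> ((norm c * M) * \<Lambda>) (\<lambda>p. c * g1 p)" "Cbound n \<Lambda> ((norm c * M) * \<Lambda>) (\<lambda>p. c * g2 p)"
    unfolding mult.assoc using g Suc.IH by blast+
  moreover have "continuous_on UNIV (\<lambda>p. c * g p)" "\<And>p. norm (c * g p) \<le> norm c * M"
    using Suc.prems by (auto intro!: continuous_intros mult_left_mono simp: norm_mult)
  ultimately show ?case
    by (intro Cbound_SucI[where ?g1.0 = "\<lambda>p. c * g1 p" and ?g2.0 = "\<lambda>p. c * g2 p"])
       (auto intro!: has_vector_derivative_mult_right g)
qed

text \<open>Leibniz rule: each differentiation splits a product into two terms with the same bound,
  so the constant doubles at every order.\<close>

lemma Cbound_mult:
  "Cbound n \<Lambda> M f \<Longrightarrow> Cbound n \<Lambda> M' g \<Longrightarrow> \<Lambda> \<ge> 0 \<Longrightarrow>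
    Cbound n \<Lambda> (2 ^ n * M * M') (\<lambda>p. f p * g p)"
proof (induction n arbitrary: M M' f g)
  case 0
  then show ?case by (auto intro!: continuous_intros mult_mono' simp: norm_mult)
next
  case (Suc n)
  from Suc.prems obtain f1 f2 g1 g2 where g:
    "\<And>t x. ((\<lambda>s. f (s, x)) has_vector_derivative f1 (t, x)) (at t)"
    "\<And>t x. ((\<lambda>y. f (t, y)) has_vector_derivative f2 (t, x)) (at x)"
    "Cbound n \<Lambda> (M * \<Lambda>) f1" "Cbound n \<Lambda> (M * \<Lambda>) f2" 
    "\<And>t x. ((\<lambda>s. g (s, x)) has_vector_derivative g1 (t, x)) (at t)"
    "\<And>t x. ((\<lambda>y. g (t, y)) has_vector_derivative g2 (t, x)) (at x)"
    "Cbound n \<Lambda> (M' * \<Lambda>) g1" "Cbound n \<Lambda> (M' * \<Lambda>) g2" by auto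
  note fg = Suc.prems(1,2)[THEN Cbound_lower]
  have "Cbound n \<Lambda> (2 ^ n * M * (M' * \<Lambda>) + 2 ^ n * (M * \<Lambda>) * M') (\<lambda>p. f p * g1 p + f1 p * g p)"
       "Cbound n \<Lambda> (2 ^ n * M * (M' * \<Lambda>) + 2 ^ n * (M * \<Lambda>) * M') (\<lambda>p. f p * g2 p + f2 p * g p)"
    by (intro Cbound_add Suc.IH g fg Suc.prems(3))+
  moreover have "2 ^ n * M * (M' * \<Lambda>) + 2 ^ n * (M * \<Lambda>) * M' = 2 ^ Suc n * M * M' * \<Lambda>"
    by (simp add: algebra_simps)
  moreover have "continuous_on UNIV (\<lambda>p. f p * g p)"
    using Suc.prems by (auto intro!: continuous_intros)
  moreover have "norm (f p * g p) \<le> 2 ^ Suc n * M * M'" for p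
  proof -
    have fg: "norm (f p) \<le> M" "norm (g p) \<le> M'"
      using fg[THEN Cbound_0] by (cases p; simp)+
    have "norm (f p * g p) \<le> M * M'"
      unfolding norm_mult using fg by (intro mult_mono') auto
    also have "\<dots> \<le> 2 ^ Suc n * (M * M')"
      using fg order_trans[OF norm_ge_zero fg(1)] order_trans[OF norm_ge_zero fg(2)]
        mult_right_mono[OF one_le_power[of "2::real" "Suc n"], of "M * M'"] by simp
    finally show ?thesis by (simp only: mult.assoc)
  qed
  ultimately show ?case
    by (intro Cbound_SucI[where ?g1.0 = "\<lambda>p. f p * g1 p + f1 p * g p"
          and ?g2.0 = "\<lambda>p. f p * g2 p + f2 p * g p"])
       (auto intro!: has_vector_derivative_mult g)
qed

section \<open>Termwise differentiation of function series\<close>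

lemma has_vector_derivative_series:
  fixes f f' :: "nat \<Rightarrow> real \<Rightarrow> 'a::banach"
  assumes f: "\<And>i x. (f i has_vector_derivative f' i x) (at x)"
    and f0: "summable (\<lambda>i. f i x)"
    and le: "\<And>i x. norm (f' i x) \<le> M i" and M: "summable M"
  shows "((\<lambda>x. \<Sum>i. f i x) has_vector_derivative (\<Sum>i. f' i x)) (at x)"
proof -
  have u: "uniform_limit UNIV (\<lambda>n x. \<Sum>i<n. f' i x) (\<lambda>x. \<Sum>i. f' i x) sequentially"
    using le M by (intro Weierstrass_m_test) auto
  have "\<exists>g. \<forall>x\<in>UNIV. (\<lambda>n. f n x) sums g x \<and>
      (g has_derivative (\<lambda>h. h *\<^sub>R (\<Sum>i. f' i x))) (at x within UNIV)"
  proof (rule has_derivative_series[where f' = "\<lambda>n x h. h *\<^sub>R f' n x" and x = x and l = "\<Sum>n. f n x"])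
    fix e :: real assume "e > 0"
    then have "\<forall>\<^sub>F n in sequentially. \<forall>x\<in>UNIV. dist (\<Sum>i<n. f' i x) (\<Sum>i. f' i x) < e"
      using u unfolding uniform_limit_iff by blast
    then show "\<forall>\<^sub>F n in sequentially. \<forall>x\<in>UNIV. \<forall>h.
      norm ((\<Sum>i<n. h *\<^sub>R f' i x) - h *\<^sub>R (\<Sum>i. f' i x)) \<le> e * norm h"
    proof eventually_elim
      case (elim n)
      have "norm ((\<Sum>i<n. h *\<^sub>R f' i x) - h *\<^sub>R (\<Sum>i. f' i x)) \<le> e * norm h" for x h
      proof -
        have "norm ((\<Sum>i<n. h *\<^sub>R f' i x) - h *\<^sub>R (\<Sum>i. f' i x)) = \<bar>h\<bar> * dist (\<Sum>i<n. f' i x) (\<Sum>i. f' i x)"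
          unfolding scaleR_right.sum[symmetric] scaleR_right_diff_distrib[symmetric] dist_norm norm_scaleR ..
        also have "\<dots> \<le> \<bar>h\<bar> * e"
          using elim by (intro mult_left_mono) (simp_all add: less_imp_le)
        finally show ?thesis by (simp add: mult.commute)
      qed
      then show ?case by blast
    qed
  next
    show "(f n has_derivative (\<lambda>h. h *\<^sub>R f' n x)) (at x within UNIV)" for n x
      using f by (simp add: has_vector_derivative_def)
    show "(\<lambda>n. f n x) sums (\<Sum>n. f n x)" using f0 by (rule summable_sums)
  qed simp_all
  then obtain g where g: "\<And>x. (\<lambda>n. f n x) sums g x"
      "\<And>x. (g has_vector_derivative (\<Sum>i. f' i x)) (at x)"
    using that[unfolded has_vector_derivative_def] by fast
  then have "(\<lambda>x. \<Sum>n. f n x) = g" by (intro ext sums_unique[symmetric])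
  with g(2) show ?thesis by simp
qed

lemma continuous_on_series:
  fixes G :: "nat \<Rightarrow> 'a::topological_space \<Rightarrow> 'b::banach"
  assumes "\<And>i. continuous_on A (G i)" "\<And>i p. p \<in> A \<Longrightarrow> norm (G i p) \<le> M i" "summable M"
  shows "continuous_on A (\<lambda>p. \<Sum>i. G i p)"
proof (rule uniform_limit_theorem)
  show "uniform_limit A (\<lambda>n p. \<Sum>i<n. G i p) (\<lambda>p. \<Sum>i. G i p) sequentially"
    using assms by (intro Weierstrass_m_test) auto
qed (use assms in \<open>auto intro!: always_eventually continuous_intros\<close>)

text \<open>Differentiating a term replaces \<open>M\<close> by \<open>M * \<Lambda>\<close>, so the
  summability hypothesis at top order passes to the series of derivatives. As
  \<open>\<Lambda> \<ge> 1\<close>, it also dominates all lower orders, where the M-test gives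
  continuity and termwise differentiation.\<close>

lemma C_diff_series:
  assumes "\<And>i::nat. Cbound n (\<Lambda> i) (M i) (G i)" "\<And>i. \<Lambda> i \<ge> 1" "summable (\<lambda>i. M i * \<Lambda> i ^ n)"
  shows "C_diff n (\<lambda>p. \<Sum>i. G i p)"
  using assms
proof (induction n arbitrary: M G)
  case 0
  then show ?case by (auto intro!: continuous_on_series[where M = M])
next
  case (Suc n)
  have G: "continuous_on UNIV (G i)" "norm (G i p) \<le> M i" for i p
    using Cbound_0[OF Suc.prems(1)[of i]] by (cases p; simp)+
  have M0: "M i \<ge> 0" for i by (rule order_trans[OF norm_ge_zero G(2)])
  define P where "P i g1 g2 \<longleftrightarrow>
      (\<forall>t x. ((\<lambda>s. G i (s, x)) has_vector_derivative g1 (t, x)) (at t)) \<and>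
      (\<forall>t x. ((\<lambda>y. G i (t, y)) has_vector_derivative g2 (t, x)) (at x)) \<and>
      Cbound n (\<Lambda> i) (M i * \<Lambda> i) g1 \<and> Cbound n (\<Lambda> i) (M i * \<Lambda> i) g2" for i g1 g2
  have "\<exists>g1 g2. P i g1 g2" for i
    using Suc.prems(1)[of i] by (auto simp: P_def)
  then obtain g1 g2 where "\<And>i. P i (g1 i) (g2 i)" by metis
  then have g:
    "\<And>i t x. ((\<lambda>s. G i (s, x)) has_vector_derivative g1 i (t, x)) (at t)"
    "\<And>i t x. ((\<lambda>y. G i (t, y)) has_vector_derivative g2 i (t, x)) (at x)"
    "\<And>i. Cbound n (\<Lambda> i) (M i * \<Lambda> i) (g1 i)" "\<And>i. Cbound n (\<Lambda> i) (M i * \<Lambda> i) (g2 i)"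
    unfolding P_def by blast+
  have sum: "summable (\<lambda>i. M i * \<Lambda> i * \<Lambda> i ^ n)"
    using Suc.prems(3) by (simp add: mult.assoc)
  have sum1: "summable (\<lambda>i. M i * \<Lambda> i)"
  proof (rule summable_comparison_test'[OF sum, of 0])
    fix i
    have "M i * \<Lambda> i * 1 \<le> M i * \<Lambda> i * \<Lambda> i ^ n"
      using Suc.prems(2)[of i] M0[of i] by (intro mult_left_mono one_le_power mult_nonneg_nonneg) auto
    then show "norm (M i * \<Lambda> i) \<le> M i * \<Lambda> i * \<Lambda> i ^ n"
      using Suc.prems(2)[of i] M0[of i] by (simp add: abs_mult)
  qed
  have sum0: "summable M"
  proof (rule summable_comparison_test'[OF sum1, of 0])
    show "norm (M i) \<le> M i * \<Lambda> i" for i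
      using Suc.prems(2)[of i] M0[of i] mult_left_mono[of 1 "\<Lambda> i" "M i"] by simp
  qed
  have le: "norm (g1 i p) \<le> M i * \<Lambda> i" "norm (g2 i p) \<le> M i * \<Lambda> i" for i p
    using Cbound_0[OF g(3)[of i]] Cbound_0[OF g(4)[of i]] by (cases p; simp)+
  have sG: "summable (\<lambda>i. G i p)" for p
    using G(2) by (intro summable_comparison_test'[OF sum0, of 0])
  show ?case
  proof (rule C_diff_SucI)
    show "continuous_on UNIV (\<lambda>p. \<Sum>i. G i p)"
      by (rule continuous_on_series[OF G sum0])
    show "C_diff n (\<lambda>p. \<Sum>i. g1 i p)" "C_diff n (\<lambda>p. \<Sum>i. g2 i p)"
      by (rule Suc.IH[OF g(3) Suc.prems(2) sum] Suc.IH[OF g(4) Suc.prems(2) sum])+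
    show "((\<lambda>s. \<Sum>i. G i (s, x)) has_vector_derivative (\<Sum>i. g1 i (t, x))) (at t)" for t x
      by (rule has_vector_derivative_series[OF g(1) sG le(1) sum1])
    show "((\<lambda>y. \<Sum>i. G i (t, y)) has_vector_derivative (\<Sum>i. g2 i (t, x))) (at x)" for t x
      by (rule has_vector_derivative_series[OF g(2) sG le(2) sum1])
  qed
qed

section \<open>Characters of the torus\<close>

definition wave :: "int \<times> int \<Rightarrow> real \<times> real \<Rightarrow> complex" where
  "wave q = (\<lambda>(t, x). exp (\<i> * of_real (t * of_int (fst q) + x * of_int (snd q))))"

lemma norm_wave [simp]: "norm (wave q p) = 1"
  by (cases p) (simp add: wave_def)

lemma wave_add: "wave (q + r) p = wave q p * wave r p"
  by (cases p) (simp add: wave_def algebra_simps flip: exp_add)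

lemma wave_0 [simp]: "wave 0 p = 1"
  by (cases p) (simp add: wave_def)

lemma has_partial_t_wave:
  "((\<lambda>s. wave q (s, x)) has_vector_derivative \<i> * of_int (fst q) * wave q (t, x)) (at t)"
proof -
  have "((\<lambda>s. exp (\<i> * (s * of_int (fst q) + of_real x * of_int (snd q)))) has_field_derivative
     \<i> * of_int (fst q) * exp (\<i> * (of_real t * of_int (fst q) + of_real x * of_int (snd q)))) (at (of_real t))"
    by (auto intro!: derivative_eq_intros)
  from has_vector_derivative_real_field[OF this] show ?thesis
    by (simp add: wave_def o_def)
qed

lemma has_partial_x_wave:
  "((\<lambda>y. wave q (t, y)) has_vector_derivative \<i> * of_int (snd q) * wave q (t, x)) (at x)"
proof -
  have "((\<lambda>y. exp (\<i> * (of_real t * of_int (fst q) + y * of_int (snd q)))) has_field_derivative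
     \<i> * of_int (snd q) * exp (\<i> * (of_real t * of_int (fst q) + of_real x * of_int (snd q)))) (at (of_real x))"
    by (auto intro!: derivative_eq_intros)
  from has_vector_derivative_real_field[OF this] show ?thesis
    by (simp add: wave_def o_def)
qed

lemma continuous_wave: "continuous_on UNIV (wave q)"
  unfolding wave_def by (auto intro!: continuous_intros simp: case_prod_unfold)

lemma periodic2_wave: "periodic2 (wave q)"
proof -
  have e: "exp (\<i> * of_real (a + 2 * pi * of_int n)) = exp (\<i> * of_real a)" for a and n :: int
  proof -
    have "exp (\<i> * (of_real (2 * pi * of_int n))) = 1"
      using exp_integer_2pi[of "of_int n"] by (simp add: mult_ac)
    then show ?thesis by (simp only: of_real_add distrib_left exp_add mult_1_right)
  qed
  have "(t + 2 * pi) * of_int i + x * of_int j = t * of_int i + x * of_int j + 2 * pi * of_int i"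
    "t * of_int i + (x + 2 * pi) * of_int j = t * of_int i + x * of_int j + 2 * pi * of_int j"
    for t x :: real and i j :: int
    by (simp_all add: algebra_simps)
  then show ?thesis
    unfolding periodic2_def wave_def prod.case by (simp only: e) simp
qed

lemma Cbound_wave:
  assumes "\<Lambda> \<ge> \<bar>of_int (fst q)\<bar>" "\<Lambda> \<ge> \<bar>of_int (snd q)\<bar>"
  shows "Cbound n \<Lambda> 1 (wave q)"
proof (induction n)
  case 0
  then show ?case by (simp add: continuous_wave)
next
  case (Suc n)
  have "Cbound n \<Lambda> (norm (\<i> * of_int (fst q)) * 1) (\<lambda>p. \<i> * of_int (fst q) * wave q p)"
       "Cbound n \<Lambda> (norm (\<i> * of_int (snd q)) * 1) (\<lambda>p. \<i> * of_int (snd q) * wave q p)"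
    by (rule Cbound_cmult[OF Suc])+
  then have "Cbound n \<Lambda> (1 * \<Lambda>) (\<lambda>p. \<i> * of_int (fst q) * wave q p)"
      "Cbound n \<Lambda> (1 * \<Lambda>) (\<lambda>p. \<i> * of_int (snd q) * wave q p)"
    using assms by (auto elim!: Cbound_mono simp: norm_mult)
  then show ?case
    by (intro Cbound_SucI[where ?g1.0 = "\<lambda>p. \<i> * of_int (fst q) * wave q p"
          and ?g2.0 = "\<lambda>p. \<i> * of_int (snd q) * wave q p"])
       (auto simp: continuous_wave intro: has_partial_t_wave has_partial_x_wave)
qed

section \<open>Trigonometric polynomials are dense in the test functions\<close>

text \<open>Symmetry of second derivatives, from separate partial derivatives that are continuous:
  write \<open>g\<close> as an integral of its \<open>t\<close>-derivative, differentiate in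
  \<open>x\<close> under the integral, and so recover \<open>partial_x g\<close> as an integral in
  \<open>t\<close>, which can be differentiated.\<close>

lemma partial_t_partial_x_commute:
  assumes "C_diff (Suc (Suc m)) g"
  shows "partial_t (partial_x g) = partial_x (partial_t g)"
proof (rule partial_t_eqI)
  fix t x
  have C: "C_diff (Suc m) (partial_t g)" "C_diff (Suc m) (partial_x g)" using assms by auto
  have gt: "continuous_on UNIV (partial_t g)" and gtx: "continuous_on UNIV (partial_x (partial_t g))"
    using C by (auto intro: C_diff_imp_continuous)
  \<comment> \<open>The base point \<open>t - 1\<close> lies strictly to the left of
    \<open>t\<close>, so the formula holds in a neighbourhood of \<open>t\<close>.\<close>
  have x: "partial_x g (u, y) = partial_x g (t - 1, y) + integral {t - 1..u} (\<lambda>s. partial_x (partial_t g) (s, y))"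
    if u: "u \<ge> t - 1" for u y
  proof -
    have "g (u, z) = g (t - 1, z) + integral (cbox (t - 1) u) (\<lambda>s. partial_t g (s, z))" for z
      using integral_unique[OF fundamental_theorem_of_calculus[OF u, of "\<lambda>s. g (s, z)" "\<lambda>s. partial_t g (s, z)"]]
        has_partial_t[OF assms, THEN has_vector_derivative_at_within] by simp
    then have eq: "(\<lambda>z. g (u, z)) = (\<lambda>z. g (t - 1, z) + integral (cbox (t - 1) u) (\<lambda>s. partial_t g (s, z)))"
      by auto
    have "((\<lambda>z. integral (cbox (t - 1) u) (\<lambda>s. partial_t g (s, z))) has_vector_derivative
        integral (cbox (t - 1) u) (\<lambda>s. partial_x (partial_t g) (s, y))) (at y within UNIV)"
    proof (rule leibniz_rule_vector_derivative)
      show "continuous_on (UNIV \<times> cbox (t - 1) u) (\<lambda>(z, s). partial_x (partial_t g) (s, z))"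
        unfolding case_prod_unfold by (intro continuous_intros continuous_on_compose2[OF gtx]) auto
      show "(\<lambda>s. partial_t g (s, z)) integrable_on cbox (t - 1) u" for z
        by (intro integrable_continuous continuous_on_compose2[OF gt] continuous_intros) auto
    qed (use has_partial_x[OF C(1)] in auto)
    then have "((\<lambda>z. g (u, z)) has_vector_derivative partial_x g (t - 1, y) +
        integral {t - 1..u} (\<lambda>s. partial_x (partial_t g) (s, y))) (at y)"
      unfolding eq by (intro has_vector_derivative_add has_partial_x[OF assms]) auto
    then show ?thesis by (simp add: partial_x_def vector_derivative_at)
  qed
  have "((\<lambda>u. integral {t - 1..u} (\<lambda>s. partial_x (partial_t g) (s, x))) has_vector_derivative
      partial_x (partial_t g) (t, x)) (at t within {t - 1..t + 1})"
    by (intro integral_has_vector_derivative continuous_on_compose2[OF gtx] continuous_intros) auto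
  then have "((\<lambda>u. integral {t - 1..u} (\<lambda>s. partial_x (partial_t g) (s, x))) has_vector_derivative
      partial_x (partial_t g) (t, x)) (at t)"
    by (simp add: at_within_Icc_at)
  from has_vector_derivative_add[OF has_vector_derivative_const this]
  have "((\<lambda>u. partial_x g (t - 1, x) + integral {t - 1..u} (\<lambda>s. partial_x (partial_t g) (s, x)))
      has_vector_derivative partial_x (partial_t g) (t, x)) (at t)" by simp
  then show "((\<lambda>u. partial_x g (u, x)) has_vector_derivative partial_x (partial_t g) (t, x)) (at t)"
  proof (rule has_vector_derivative_transform_within_open[where S = "{t - 1<..}"])
    show "partial_x g (t - 1, x) + integral {t - 1..u} (\<lambda>s. partial_x (partial_t g) (s, x)) = partial_x g (u, x)"
      if "u \<in> {t - 1<..}" for u using x[of u x] that by simp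
  qed auto
qed

section \<open>Closure properties of the test functions\<close>

lemma test_fun_C_diff: "\<phi> \<in> test_fun \<Longrightarrow> C_diff m \<phi>"
  by (simp add: test_fun_def)

lemma test_fun_continuous: "\<phi> \<in> test_fun \<Longrightarrow> continuous_on UNIV \<phi>"
  by (rule C_diff_imp_continuous[OF test_fun_C_diff])

lemma test_fun_periodic2: "\<phi> \<in> test_fun \<Longrightarrow> periodic2 \<phi>"
  by (simp add: test_fun_def)

lemma test_fun_partial_t: "\<phi> \<in> test_fun \<Longrightarrow> partial_t \<phi> \<in> test_fun"
  unfolding test_fun_def using C_diff.simps(2) periodic2_partial_t by blast

lemma test_fun_partial_x: "\<phi> \<in> test_fun \<Longrightarrow> partial_x \<phi> \<in> test_fun"
  unfolding test_fun_def using C_diff.simps(2) periodic2_partial_x by blast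

lemma test_fun_add: "\<phi> \<in> test_fun \<Longrightarrow> \<psi> \<in> test_fun \<Longrightarrow> (\<lambda>p. \<phi> p + \<psi> p) \<in> test_fun"
  unfolding test_fun_def by (auto intro: C_diff_add simp: periodic2_def)

lemma test_fun_cmult: "\<phi> \<in> test_fun \<Longrightarrow> (\<lambda>p. c * \<phi> p) \<in> test_fun"
  unfolding test_fun_def by (auto intro: C_diff_cmult simp: periodic2_def)

lemma test_fun_diff: "\<phi> \<in> test_fun \<Longrightarrow> \<psi> \<in> test_fun \<Longrightarrow> (\<lambda>p. \<phi> p - \<psi> p) \<in> test_fun"
  using test_fun_add[of \<phi> "\<lambda>p. (- 1) * \<psi> p"] test_fun_cmult[of \<psi> "- 1"] by simp

lemma test_fun_wave: "wave q \<in> test_fun"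
  unfolding test_fun_def
  using Cbound_imp_C_diff[OF Cbound_wave[of q "\<bar>of_int (fst q)\<bar> + \<bar>of_int (snd q)\<bar>"]]
  by (auto simp: periodic2_wave)

lemma test_fun_has_partial_t:
  "\<phi> \<in> test_fun \<Longrightarrow> ((\<lambda>s. \<phi> (s, x)) has_vector_derivative partial_t \<phi> (t, x)) (at t)"
  by (rule has_partial_t[OF test_fun_C_diff])

lemma test_fun_has_partial_x:
  "\<phi> \<in> test_fun \<Longrightarrow> ((\<lambda>y. \<phi> (t, y)) has_vector_derivative partial_x \<phi> (t, x)) (at x)"
  by (rule has_partial_x[OF test_fun_C_diff])

lemma partial_add:
  assumes "\<phi> \<in> test_fun" "\<psi> \<in> test_fun"
  shows "partial_t (\<lambda>p. \<phi> p + \<psi> p) = (\<lambda>p. partial_t \<phi> p + partial_t \<psi> p)"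
    and "partial_x (\<lambda>p. \<phi> p + \<psi> p) = (\<lambda>p. partial_x \<phi> p + partial_x \<psi> p)"
  by (intro partial_t_eqI partial_x_eqI has_vector_derivative_add
      assms[THEN test_fun_has_partial_t] assms[THEN test_fun_has_partial_x])+

lemma partial_cmult:
  assumes "\<phi> \<in> test_fun"
  shows "partial_t (\<lambda>p. c * \<phi> p) = (\<lambda>p. c * partial_t \<phi> p)"
    and "partial_x (\<lambda>p. c * \<phi> p) = (\<lambda>p. c * partial_x \<phi> p)"
  by (intro partial_t_eqI partial_x_eqI has_vector_derivative_mult_right
      assms[THEN test_fun_has_partial_t] assms[THEN test_fun_has_partial_x])+

lemma partial_wave:
  "partial_t (wave q) = (\<lambda>p. \<i> * of_int (fst q) * wave q p)"
  "partial_x (wave q) = (\<lambda>p. \<i> * of_int (snd q) * wave q p)"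
  by (intro partial_t_eqI partial_x_eqI has_partial_t_wave has_partial_x_wave)+

text \<open>
  At a maximum of \<open>|g|\<close> the derivative \<open>g'\<close> is orthogonal to \<open>g\<close>, so \<open>|g| \<le> sup |g - g'|\<close>.
  Applied in each variable, this bounds all derivatives of order at most \<open>N\<close> of \<open>\<phi>\<close> by
  \<open>(1 - \<partial>\<^sub>x)\<^sup>N (1 - \<partial>\<^sub>t)\<^sup>N \<phi>\<close>, which need only be approximated uniformly.
\<close>

lemma critical_norm_le:
  fixes g :: "real \<Rightarrow> complex"
  assumes D: "(g has_vector_derivative g') (at t)" and max: "\<And>s. norm (g s) \<le> norm (g t)"
    and M: "norm (g t - g') \<le> M"
  shows "norm (g t) \<le> M"
proof -
  \<comment> \<open>Projecting onto the fixed direction \<open>g t\<close> avoids differentiating a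
    modulus. The projection is at most \<open>norm (g t) * norm (g s)\<close>, so it is also maximal
    at \<open>t\<close>.\<close>
  have "((\<lambda>s. Re (cnj (g t) * g s)) has_vector_derivative Re (cnj (g t) * g')) (at t)"
    by (intro has_vector_derivative_mult_right D bounded_linear.has_vector_derivative[OF bounded_linear_Re])
  then have "DERIV (\<lambda>s. Re (cnj (g t) * g s)) t :> Re (cnj (g t) * g')"
    by (simp add: has_real_derivative_iff_has_vector_derivative)
  moreover have "Re (cnj (g t) * g s) \<le> Re (cnj (g t) * g t)" for s
  proof -
    have "Re (cnj (g t) * g s) \<le> norm (cnj (g t) * g s)" by (rule complex_Re_le_cmod)
    also have "\<dots> \<le> norm (g t) * norm (g t)" using max by (auto simp: norm_mult intro: mult_left_mono)
    also have "\<dots> = Re (cnj (g t) * g t)"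
      by (simp add: cmod_def flip: power2_eq_square)
    finally show ?thesis .
  qed
  ultimately have 0: "Re (cnj (g t) * g') = 0"
    by (intro DERIV_local_max[where d = 1]) auto
  have "norm (g t) * norm (g t) = Re (cnj (g t) * (g t - g'))"
    using 0 by (simp add: right_diff_distrib cmod_def flip: power2_eq_square)
  also have "\<dots> \<le> norm (cnj (g t) * (g t - g'))" by (rule complex_Re_le_cmod)
  also have "\<dots> \<le> norm (g t) * M" using M by (auto simp: norm_mult intro: mult_left_mono)
  finally show ?thesis
    using order_trans[OF norm_ge_zero M] by (cases "g t = 0") auto
qed

text \<open>On a character of frequency \<open>n\<close> in the chosen variable this acts as
  multiplication by \<open>1 - \<i> * n\<close>, which never vanishes, whereas \<open>D\<close>
  alone would kill frequency 0. It is therefore invertible on trigonometric polynomials.\<close>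

definition id_minus :: "((real \<times> real \<Rightarrow> complex) \<Rightarrow> real \<times> real \<Rightarrow> complex) \<Rightarrow>
    (real \<times> real \<Rightarrow> complex) \<Rightarrow> real \<times> real \<Rightarrow> complex" where
  "id_minus D g = (\<lambda>p. g p - D g p)"

lemma norm_le_id_minus:
  assumes D: "D \<in> {partial_t, partial_x}" and g: "g \<in> test_fun"
    and M: "\<And>p. norm (id_minus D g p) \<le> M"
  shows "norm (g p) \<le> M"
proof -
  obtain r where r: "\<And>q. norm (g q) \<le> norm (g r)"
    using periodic2_attains_max[OF test_fun_periodic2 test_fun_continuous] g by blast
  obtain t x where tx: "r = (t, x)" by force
  have "norm (g (t, x)) \<le> M"
    using D M[of "(t, x)"] r
      critical_norm_le[OF test_fun_has_partial_t[OF g], of x t M]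
      critical_norm_le[OF test_fun_has_partial_x[OF g], of t x M]
    by (auto simp: id_minus_def tx)
  then show ?thesis using r[of p] tx by auto
qed

lemma test_fun_partial: "D \<in> {partial_t, partial_x} \<Longrightarrow> \<phi> \<in> test_fun \<Longrightarrow> D \<phi> \<in> test_fun"
  using test_fun_partial_t test_fun_partial_x by auto

lemma partial_lincomb:
  assumes "D \<in> {partial_t, partial_x}" "\<phi> \<in> test_fun" "\<psi> \<in> test_fun"
  shows "D (\<lambda>p. \<phi> p + c * \<psi> p) = (\<lambda>p. D \<phi> p + c * D \<psi> p)"
  using assms(1) partial_add[OF assms(2) test_fun_cmult[OF assms(3), of c]]
    partial_cmult[OF assms(3), of c] by auto

lemma partial_commute:
  "D \<in> {partial_t, partial_x} \<Longrightarrow> E \<in> {partial_t, partial_x} \<Longrightarrow> \<phi> \<in> test_fun \<Longrightarrow> D (E \<phi>) = E (D \<phi>)"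
  using partial_t_partial_x_commute[OF test_fun_C_diff] by auto

lemma test_fun_id_minus:
  "D \<in> {partial_t, partial_x} \<Longrightarrow> \<phi> \<in> test_fun \<Longrightarrow> id_minus D \<phi> \<in> test_fun"
  unfolding id_minus_def by (rule test_fun_diff[OF _ test_fun_partial])

lemma test_fun_funpow_partial:
  assumes "D \<in> {partial_t, partial_x}" "\<phi> \<in> test_fun"
  shows "(D ^^ n) \<phi> \<in> test_fun"
proof (induction n)
  case (Suc n)
  show ?case using test_fun_partial[OF assms(1) Suc] by simp
qed (use assms in simp)

lemma test_fun_funpow_id_minus:
  assumes "D \<in> {partial_t, partial_x}" "\<phi> \<in> test_fun"
  shows "(id_minus D ^^ n) \<phi> \<in> test_fun"
proof (induction n)
  case (Suc n)
  show ?case using test_fun_id_minus[OF assms(1) Suc] by simp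
qed (use assms in simp)

lemma id_minus_lincomb:
  assumes "D \<in> {partial_t, partial_x}" "\<phi> \<in> test_fun" "\<psi> \<in> test_fun"
  shows "id_minus D (\<lambda>p. \<phi> p + c * \<psi> p) = (\<lambda>p. id_minus D \<phi> p + c * id_minus D \<psi> p)"
  unfolding id_minus_def partial_lincomb[OF assms] by (simp add: algebra_simps)

lemma funpow_id_minus_lincomb:
  assumes "D \<in> {partial_t, partial_x}" "\<phi> \<in> test_fun" "\<psi> \<in> test_fun"
  shows "(id_minus D ^^ n) (\<lambda>p. \<phi> p + c * \<psi> p) =
    (\<lambda>p. (id_minus D ^^ n) \<phi> p + c * (id_minus D ^^ n) \<psi> p)"
proof (induction n)
  case (Suc n)
  then show ?case
    using id_minus_lincomb[OF assms(1) test_fun_funpow_id_minus[OF assms(1,2)]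
        test_fun_funpow_id_minus[OF assms(1,3)]] by simp
qed auto

lemma id_minus_commute:
  assumes "D \<in> {partial_t, partial_x}" "E \<in> {partial_t, partial_x}" "\<phi> \<in> test_fun"
  shows "E (id_minus D \<phi>) = id_minus D (E \<phi>)"
  using partial_lincomb[OF assms(2,3) test_fun_partial[OF assms(1,3)], of "- 1"] partial_commute[OF assms]
  by (simp add: id_minus_def)

lemma id_minus_commute_funpow:
  assumes "D \<in> {partial_t, partial_x}" "E \<in> {partial_t, partial_x}" "\<phi> \<in> test_fun"
  shows "(E ^^ j) (id_minus D \<phi>) = id_minus D ((E ^^ j) \<phi>)"
  by (induction j) (simp_all add: id_minus_commute[OF assms(1,2)] test_fun_funpow_partial[OF assms(2,3)])

lemma funpow_id_minus_commute_funpow: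
  assumes "D \<in> {partial_t, partial_x}" "E \<in> {partial_t, partial_x}" "\<phi> \<in> test_fun"
  shows "(E ^^ j) ((id_minus D ^^ n) \<phi>) = (id_minus D ^^ n) ((E ^^ j) \<phi>)"
  by (induction n)
    (simp_all add: id_minus_commute_funpow[OF assms(1,2)] test_fun_funpow_id_minus[OF assms(1,3)])

text \<open>The induction hypothesis for \<open>id_minus D \<phi>\<close> bounds
  \<open>id_minus D ((D ^^ j) \<phi>)\<close> by \<open>2 ^ j * M\<close>, hence also
  \<open>(D ^^ j) \<phi>\<close> by the maximum argument. The top derivative is the difference of
  these two functions for \<open>j = n\<close>, which accounts for the doubling.\<close>

lemma norm_funpow_partial_le:
  assumes D: "D \<in> {partial_t, partial_x}"
  shows "\<phi> \<in> test_fun \<Longrightarrow> (\<And>p. norm ((id_minus D ^^ n) \<phi> p) \<le> M) \<Longrightarrow> i \<le> n \<Longrightarrow>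
    norm ((D ^^ i) \<phi> p) \<le> 2 ^ i * M"
proof (induction n arbitrary: \<phi> i p)
  case (Suc n)
  have "norm ((id_minus D ^^ n) (id_minus D \<phi>) q) \<le> M" for q
    using Suc.prems(2)[of q] by (simp add: funpow_swap1)
  note IH = Suc.IH[OF test_fun_id_minus[OF D Suc.prems(1)] this]
  have D1: "norm (id_minus D ((D ^^ j) \<phi>) q) \<le> 2 ^ j * M" if "j \<le> n" for j q
    using IH[OF that] id_minus_commute_funpow[OF D D Suc.prems(1)] by simp
  have le: "norm ((D ^^ j) \<phi> q) \<le> 2 ^ j * M" if "j \<le> n" for j q
    by (rule norm_le_id_minus[OF D test_fun_funpow_partial[OF D Suc.prems(1)] D1[OF that]])
  show ?case
  proof (cases "i \<le> n")
    case False
    then have i: "i = Suc n" using Suc.prems by simp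
    have "(D ^^ i) \<phi> p = (D ^^ n) \<phi> p - id_minus D ((D ^^ n) \<phi>) p"
      by (simp add: i id_minus_def)
    then have "norm ((D ^^ i) \<phi> p) \<le> 2 ^ n * M + 2 ^ n * M"
      using order_trans[OF norm_triangle_ineq4 add_mono[OF le[OF order_refl] D1[OF order_refl]]]
      by simp
    then show ?thesis by (simp add: i algebra_simps)
  qed (rule le)
qed auto

text \<open>The variables are treated one after the other, using that the operators commute. Each
  contributes at most \<open>2 ^ N\<close>, and \<open>(N + 1)\<^sup>2\<close> counts the terms of
  the double sum.\<close>

lemma test_seminorm_le:
  assumes \<phi>: "\<phi> \<in> test_fun"
    and M: "\<And>p. norm ((id_minus partial_x ^^ N) ((id_minus partial_t ^^ N) \<phi>) p) \<le> M"
  shows "test_seminorm N \<phi> \<le> (N + 1)\<^sup>2 * 4 ^ N * M"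
proof -
  have M0: "M \<ge> 0" using order_trans[OF norm_ge_zero M] by blast
  have *: "(SUP p. norm ((partial_t ^^ i) ((partial_x ^^ j) \<phi>) p)) \<le> 4 ^ N * M" if ij: "i \<le> N" "j \<le> N" for i j
  proof (rule cSUP_least)
    fix p
    have "norm ((partial_x ^^ j) ((id_minus partial_t ^^ N) \<phi>) q) \<le> 2 ^ j * M" for q
      by (rule norm_funpow_partial_le[OF _ test_fun_funpow_id_minus[OF _ \<phi>] M ij(2)]) auto
    then have "norm ((id_minus partial_t ^^ N) ((partial_x ^^ j) \<phi>) q) \<le> 2 ^ j * M" for q
      using \<phi> by (simp add: funpow_id_minus_commute_funpow)
    then have "norm ((partial_t ^^ i) ((partial_x ^^ j) \<phi>) p) \<le> 2 ^ i * (2 ^ j * M)"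
      using \<phi> ij(1) by (intro norm_funpow_partial_le test_fun_funpow_partial) auto
    also have "\<dots> \<le> 2 ^ N * (2 ^ N * M)"
      using M0 ij by (intro mult_mono power_increasing) auto
    finally show "norm ((partial_t ^^ i) ((partial_x ^^ j) \<phi>) p) \<le> 4 ^ N * M"
      by (simp flip: mult.assoc power_mult_distrib)
  qed auto
  have "test_seminorm N \<phi> \<le> (\<Sum>i\<le>N. \<Sum>j\<le>N. 4 ^ N * M)"
    unfolding test_seminorm_def using * by (intro sum_mono) auto
  then show ?thesis by (simp add: power2_eq_square algebra_simps)
qed

section \<open>Trigonometric polynomials and their density\<close>

inductive trig_poly :: "(real \<times> real \<Rightarrow> complex) \<Rightarrow> bool" where
  wave: "trig_poly (\<lambda>p. c * wave q p)"
| add: "trig_poly f \<Longrightarrow> trig_poly g \<Longrightarrow> trig_poly (\<lambda>p. f p + g p)"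

lemma trig_poly_const: "trig_poly (\<lambda>p. c)"
  using trig_poly.wave[of c 0] by simp

lemma trig_poly_mult_wave: "trig_poly g \<Longrightarrow> trig_poly (\<lambda>p. c * wave q p * g p)"
proof (induction rule: trig_poly.induct)
  case (wave d r)
  then show ?case using trig_poly.wave[of "c * d" "q + r"] by (simp add: wave_add mult_ac)
next
  case (add f g)
  then show ?case using trig_poly.add[OF add.IH] by (simp add: distrib_left)
qed

lemma trig_poly_mult: "trig_poly f \<Longrightarrow> trig_poly g \<Longrightarrow> trig_poly (\<lambda>p. f p * g p)"
proof (induction rule: trig_poly.induct)
  case (wave d r)
  then show ?case by (rule trig_poly_mult_wave)
next
  case (add f g)
  then show ?case using trig_poly.add[OF add.IH] by (simp add: distrib_right)
qed

lemma trig_poly_cmult: "trig_poly f \<Longrightarrow> trig_poly (\<lambda>p. c * f p)"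
  by (intro trig_poly_mult trig_poly_const)

lemma trig_poly_test_fun: "trig_poly f \<Longrightarrow> f \<in> test_fun"
  by (induction rule: trig_poly.induct) (auto intro: test_fun_add test_fun_cmult test_fun_wave)

lemma funpow_eigenvector:
  fixes a c :: complex
  assumes "\<And>c. F (\<lambda>p. c * w p) = (\<lambda>p. (c * a) * w p)"
  shows "(F ^^ n) (\<lambda>p. c * w p) = (\<lambda>p. (c * a ^ n) * w p)"
proof (induction n)
  case (Suc n)
  have "(F ^^ Suc n) (\<lambda>p. c * w p) = (\<lambda>p. (c * a ^ n * a) * w p)"
    unfolding funpow.simps o_apply Suc by (rule assms)
  then show ?case by (simp add: mult_ac)
qed simp

lemma funpow_id_minus_wave:
  "(id_minus partial_t ^^ n) (\<lambda>p. c * wave q p) = (\<lambda>p. (c * (1 - \<i> * of_int (fst q)) ^ n) * wave q p)"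
  "(id_minus partial_x ^^ n) (\<lambda>p. c * wave q p) = (\<lambda>p. (c * (1 - \<i> * of_int (snd q)) ^ n) * wave q p)"
  by (rule funpow_eigenvector,
      simp add: id_minus_def partial_cmult[OF test_fun_wave] partial_wave algebra_simps)+

lemma trig_poly_solve:
  "trig_poly Q \<Longrightarrow> \<exists>P. trig_poly P \<and> (id_minus partial_x ^^ N) ((id_minus partial_t ^^ N) P) = Q"
proof (induction rule: trig_poly.induct)
  case (wave c q)
  have "1 - \<i> * of_int n \<noteq> 0" for n :: int by (simp add: complex_eq_iff)
  then have "(id_minus partial_x ^^ N) ((id_minus partial_t ^^ N)
      (\<lambda>p. c / ((1 - \<i> * of_int (fst q)) ^ N * (1 - \<i> * of_int (snd q)) ^ N) * wave q p)) = (\<lambda>p. c * wave q p)"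
    by (simp only: funpow_id_minus_wave) (simp add: field_simps)
  then show ?case using trig_poly.wave by blast
next
  case (add f g)
  then obtain P Q where PQ: "trig_poly P" "trig_poly Q"
    "(id_minus partial_x ^^ N) ((id_minus partial_t ^^ N) P) = f"
    "(id_minus partial_x ^^ N) ((id_minus partial_t ^^ N) Q) = g" by blast
  note lin = funpow_id_minus_lincomb[where c = 1, simplified mult_1]
  have "(id_minus partial_x ^^ N) ((id_minus partial_t ^^ N) (\<lambda>p. P p + Q p)) = (\<lambda>p. f p + g p)"
    using lin[of partial_t P Q N] lin[of partial_x "(id_minus partial_t ^^ N) P" "(id_minus partial_t ^^ N) Q" N]
    by (simp add: trig_poly_test_fun PQ test_fun_funpow_id_minus)
  then show ?case using trig_poly.add[OF PQ(1,2)] by blast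
qed

text \<open>A real-linear functional on pairs of complex numbers is fixed by its values on
  \<open>(1, 0)\<close>, \<open>(\<i>, 0)\<close>, \<open>(0, 1)\<close>, \<open>(0, \<i>)\<close>,
  so along \<open>(cis t, cis x)\<close> it is a combination of cosines and sines. Products stay in
  the class because characters multiply to characters.\<close>

lemma trig_poly_real_polynomial:
  "real_polynomial_function r \<Longrightarrow> trig_poly (\<lambda>(t, x). of_real (r (cis t, cis x)))"
proof (induction rule: real_polynomial_function.induct)
  case (linear f)
  interpret f: bounded_linear f by fact
  have f: "f (cis t, cis x) = cos t * f (1, 0) + sin t * f (\<i>, 0) + cos x * f (0, 1) + sin x * f (0, \<i>)" for t x
  proof -
    have "(cis t, cis x) = cos t *\<^sub>R (1, 0) + sin t *\<^sub>R (\<i>, 0) + cos x *\<^sub>R (0, 1) + sin x *\<^sub>R (0, \<i>)"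
      by (simp add: complex_eq_iff)
    then show ?thesis by (simp only: f.add f.scaleR real_scaleR_def)
  qed
  have w: "wave (1, 0) (t, x) = exp (\<i> * t)" "wave (- (1, 0)) (t, x) = exp (- (\<i> * t))"
    "wave (0, 1) (t, x) = exp (\<i> * x)" "wave (- (0, 1)) (t, x) = exp (- (\<i> * x))" for t x
    by (simp_all add: wave_def)
  have e: "of_real (cos s) = (exp (\<i> * s) + exp (- (\<i> * s))) / 2"
    "of_real (sin s) = (exp (\<i> * s) - exp (- (\<i> * s))) / (2 * \<i>)" for s :: real
    unfolding cos_of_real[symmetric] sin_of_real[symmetric] by (rule cos_exp_eq sin_exp_eq)+
  have alg: "c * ((z + w) / 2) = c / 2 * z + c / 2 * w"
     "c * ((z - w) / (2 * \<i>)) = c / (2 * \<i>) * z + - (c / (2 * \<i>)) * w" for c z w :: complex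
    by (simp_all add: add_divide_distrib diff_divide_distrib distrib_left right_diff_distrib mult_ac)
  have "(\<lambda>(t, x). of_real (f (cis t, cis x))) = (\<lambda>p.
      (of_real (f (1, 0)) / 2 * wave (1, 0) p + of_real (f (1, 0)) / 2 * wave (- (1, 0)) p)
    + (of_real (f (\<i>, 0)) / (2 * \<i>) * wave (1, 0) p + - (of_real (f (\<i>, 0)) / (2 * \<i>)) * wave (- (1, 0)) p)
    + (of_real (f (0, 1)) / 2 * wave (0, 1) p + of_real (f (0, 1)) / 2 * wave (- (0, 1)) p)
    + (of_real (f (0, \<i>)) / (2 * \<i>) * wave (0, 1) p + - (of_real (f (0, \<i>)) / (2 * \<i>)) * wave (- (0, 1)) p))"
    (is "_ = ?R")
  proof
    fix p :: "real \<times> real"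
    obtain t x where p: "p = (t, x)" by force
    have "of_real (f (cis t, cis x)) = of_real (f (1, 0)) * complex_of_real (cos t)
      + of_real (f (\<i>, 0)) * complex_of_real (sin t)
      + of_real (f (0, 1)) * complex_of_real (cos x) + of_real (f (0, \<i>)) * complex_of_real (sin x)"
      unfolding f of_real_add of_real_mult by (simp only: mult.commute)
    then show "(case p of (t, x) \<Rightarrow> of_real (f (cis t, cis x))) = ?R p"
      unfolding p prod.case e alg w .
  qed
  then show ?case
    by (simp only:) (intro trig_poly.add trig_poly.wave)
next
  case (const c)
  show ?case using trig_poly_const[of "of_real c"] unfolding case_prod_unfold .
next
  case (add f g)
  show ?case
    using trig_poly.add[OF add.IH] unfolding case_prod_unfold of_real_add .
next
  case (mult f g)
  show ?case
    using trig_poly_mult[OF mult.IH] unfolding case_prod_unfold of_real_mult .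
qed

lemma periodic2_eq_if_cis_eq:
  assumes "periodic2 h" "cis t = cis t'" "cis x = cis x'"
  shows "h (t, x) = h (t', x')"
proof -
  have *: "\<exists>n::int. s = s' + 2 * pi * of_int n" if "cis s = cis s'" for s s' :: real
    using that exp_eq[of "\<i> * of_real s" "\<i> * of_real s'"]
    by (auto simp: cis_conv_exp complex_eq_iff)
  from *[OF assms(2)] *[OF assms(3)] show ?thesis
    using periodic2_shift[OF assms(1)] by auto
qed

text \<open>The torus is embedded through \<open>(cis t, cis x)\<close>, and the Stone-Weierstrass
  theorem is applied on its compact image; polynomials pull back to trigonometric
  polynomials.\<close>

lemma trig_poly_uniform_dense:
  assumes h: "periodic2 h" "continuous_on UNIV h" and e: "e > 0"
  obtains P where "trig_poly P" "\<And>p. norm (h p - P p) < e"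
proof -
  define q :: "real \<times> real \<Rightarrow> complex \<times> complex" where "q = (\<lambda>p. (cis (fst p), cis (snd p)))"
  define K where "K = cbox (0 :: real, 0 :: real) (2 * pi, 2 * pi)"
  \<comment> \<open>The choice of preimage is immaterial: points with the same image differ by
    periods, and \<open>h\<close> is periodic.\<close>
  define H where "H z = h (SOME p. p \<in> K \<and> q p = z)" for z
  have qc: "continuous_on A q" for A unfolding q_def by (intro continuous_intros)
  have Hq: "H (q p) = h p" if "p \<in> K" for p
  proof -
    have "q (SOME r. r \<in> K \<and> q r = q p) = q p"
      using someI[of "\<lambda>r. r \<in> K \<and> q r = q p" p] that by blast
    moreover have "h r = h p" if "q r = q p" for r
      using periodic2_eq_if_cis_eq[OF h(1), of "fst r" "fst p" "snd r" "snd p"] that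
      by (simp add: q_def)
    ultimately show ?thesis unfolding H_def by blast
  qed
  have S: "compact (q ` K)" unfolding K_def by (intro compact_continuous_image qc compact_cbox)
  have "continuous_on (q ` K) H"
    unfolding continuous_on_closed_vimage[OF compact_imp_closed[OF S]]
  proof safe
    fix B :: "complex set" assume B: "closed B"
    have "H -` B \<inter> q ` K = q ` (K \<inter> h -` B)" using Hq by auto
    moreover have "compact (K \<inter> h -` B)"
      unfolding K_def by (intro compact_Int_closed compact_cbox closed_vimage[OF B h(2)])
    ultimately show "closed (H -` B \<inter> q ` K)"
      using compact_imp_closed[OF compact_continuous_image[OF qc]] by simp
  qed
  from Stone_Weierstrass_polynomial_function[OF S this e] obtain g where
    g: "polynomial_function g" "\<And>z. z \<in> q ` K \<Longrightarrow> norm (H z - g z) < e" by blast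
  define P where "P p = g (q p)" for p
  have r: "real_polynomial_function (\<lambda>z. Re (g z))" "real_polynomial_function (\<lambda>z. Im (g z))"
    using g(1)[unfolded polynomial_function_def, rule_format] bounded_linear_Re bounded_linear_Im
    unfolding o_def by blast+
  have "trig_poly (\<lambda>p. of_real (Re (P p)) + \<i> * of_real (Im (P p)))"
    using trig_poly.add[OF trig_poly_real_polynomial[OF r(1)]
      trig_poly_cmult[OF trig_poly_real_polynomial[OF r(2)], of \<i>]]
    by (simp add: P_def q_def case_prod_unfold)
  then have P: "trig_poly P" by (simp flip: complex_eq)
  have "norm (h p - P p) < e" for p
  proof -
    have per: "periodic2 (\<lambda>p. h p - P p)"
      using h(1) by (auto simp: periodic2_def P_def q_def simp flip: cis_mult)
    obtain p' where p': "p' \<in> K" "h p - P p = h p' - P p'"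
      using periodic2_rep[OF per, of p] unfolding K_def by blast
    then show ?thesis using g(2)[of "q p'"] Hq[of p'] by (simp add: P_def)
  qed
  with P that show ?thesis by blast
qed

text \<open>Approximate \<open>?T \<phi>\<close> uniformly by some \<open>Q\<close> and solve
  \<open>?T P = Q\<close> exactly among trigonometric polynomials. The seminorm of
  \<open>\<phi> - P\<close> is then controlled by the supremum of
  \<open>?T \<phi> - Q\<close>.\<close>

lemma trig_poly_dense:
  assumes "\<phi> \<in> test_fun" "e > 0"
  obtains P where "trig_poly P" "test_seminorm N (\<lambda>p. \<phi> p - P p) < e"
proof -
  let ?T = "\<lambda>\<phi>. (id_minus partial_x ^^ N) ((id_minus partial_t ^^ N) \<phi>)"
  define K where "K = (real N + 1)\<^sup>2 * 4 ^ N"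
  have K: "K > 0" by (simp add: K_def add_nonneg_pos)
  have T: "?T \<phi> \<in> test_fun" using assms(1) by (simp add: test_fun_funpow_id_minus)
  \<comment> \<open>\<open>K\<close> is the constant of \<open>test_seminorm_le\<close>; the factor
    2 turns its weak inequality into a strict one.\<close>
  have "e / (2 * K) > 0" using K assms by simp
  then obtain Q where Q: "trig_poly Q" "\<And>p. norm (?T \<phi> p - Q p) < e / (2 * K)"
    using trig_poly_uniform_dense[OF test_fun_periodic2[OF T] test_fun_continuous[OF T]] by blast
  obtain P where P: "trig_poly P" "?T P = Q" using trig_poly_solve[OF Q(1)] by blast
  note P' = trig_poly_test_fun[OF P(1)]
  have "?T (\<lambda>p. \<phi> p + (- 1) * P p) = (\<lambda>p. ?T \<phi> p + (- 1) * ?T P p)"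
    by (simp only: funpow_id_minus_lincomb[of partial_t \<phi> P] funpow_id_minus_lincomb[of partial_x]
        insert_iff simp_thms assms(1) P' test_fun_funpow_id_minus[of partial_t])
  then have "norm (?T (\<lambda>p. \<phi> p - P p) p) \<le> e / (2 * K)" for p
    using Q(2)[of p] P(2) by simp
  from test_seminorm_le[OF test_fun_diff[OF assms(1) P'] this]
  have "test_seminorm N (\<lambda>p. \<phi> p - P p) \<le> K * (e / (2 * K))" by (simp add: K_def)
  also have "\<dots> < e" using K assms by simp
  finally show ?thesis using P(1) that by blast
qed

section \<open>Distributions on the torus\<close>

lemma funpow_partials_test_fun:
  "\<phi> \<in> test_fun \<Longrightarrow> (partial_t ^^ i) ((partial_x ^^ j) \<phi>) \<in> test_fun"
  by (rule test_fun_funpow_partial[OF _ test_fun_funpow_partial]) auto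

lemma norm_le_SUP_test_fun:
  assumes "\<phi> \<in> test_fun"
  shows "norm (\<phi> p) \<le> (SUP p. norm (\<phi> p))"
  by (intro cSUP_upper periodic2_bdd test_fun_periodic2 test_fun_continuous assms) auto

lemma SUP_test_fun_nonneg:
  assumes "\<phi> \<in> test_fun"
  shows "0 \<le> (SUP p. norm (\<phi> p))"
  by (rule order_trans[OF norm_ge_zero norm_le_SUP_test_fun[OF assms, of undefined]])

lemma test_seminorm_nonneg:
  assumes "\<phi> \<in> test_fun"
  shows "0 \<le> test_seminorm N \<phi>"
  unfolding test_seminorm_def
  by (intro sum_nonneg SUP_test_fun_nonneg funpow_partials_test_fun assms)

lemma test_seminorm_mono:
  assumes "\<phi> \<in> test_fun" "N \<le> N'"
  shows "test_seminorm N \<phi> \<le> test_seminorm N' \<phi>"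
  unfolding test_seminorm_def
proof (rule order_trans[OF sum_mono sum_mono2])
  fix i
  show "(\<Sum>j\<le>N. SUP p. cmod ((partial_t ^^ i) ((partial_x ^^ j) \<phi>) p))
    \<le> (\<Sum>j\<le>N'. SUP p. cmod ((partial_t ^^ i) ((partial_x ^^ j) \<phi>) p))"
    using assms by (intro sum_mono2 SUP_test_fun_nonneg funpow_partials_test_fun) auto
  show "0 \<le> (\<Sum>j\<le>N'. SUP p. cmod ((partial_t ^^ i) ((partial_x ^^ j) \<phi>) p))"
    by (intro sum_nonneg SUP_test_fun_nonneg funpow_partials_test_fun assms)
qed (use assms in auto)

lemma norm_le_test_seminorm: "\<phi> \<in> test_fun \<Longrightarrow> norm (\<phi> p) \<le> test_seminorm 0 \<phi>"
  using norm_le_SUP_test_fun by (simp add: test_seminorm_def)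

lemma distribution_add:
  "distribution u \<Longrightarrow> \<phi> \<in> test_fun \<Longrightarrow> \<psi> \<in> test_fun \<Longrightarrow> u (\<lambda>p. \<phi> p + \<psi> p) = u \<phi> + u \<psi>"
  by (simp add: distribution_def)

lemma distribution_cmult:
  "distribution u \<Longrightarrow> \<phi> \<in> test_fun \<Longrightarrow> u (\<lambda>p. c * \<phi> p) = c * u \<phi>"
  by (simp add: distribution_def)

lemma distribution_diff:
  "distribution u \<Longrightarrow> \<phi> \<in> test_fun \<Longrightarrow> \<psi> \<in> test_fun \<Longrightarrow> u (\<lambda>p. \<phi> p - \<psi> p) = u \<phi> - u \<psi>"
  using distribution_add[of u \<phi> "\<lambda>p. (- 1) * \<psi> p"] distribution_cmult[of u \<psi> "- 1"]
    test_fun_cmult[of \<psi> "- 1"] by simp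

text \<open>A nonnegative constant and the freedom to raise the index allow two distributions to be
  estimated by one common seminorm.\<close>

lemma distribution_bound:
  assumes "distribution u"
  obtains C N where "C \<ge> 0"
    "\<And>N' \<phi>. \<phi> \<in> test_fun \<Longrightarrow> N \<le> N' \<Longrightarrow> norm (u \<phi>) \<le> C * test_seminorm N' \<phi>"
proof -
  from assms obtain C N where CN: "\<And>\<phi>. \<phi> \<in> test_fun \<Longrightarrow> cmod (u \<phi>) \<le> C * test_seminorm N \<phi>"
    unfolding distribution_def by blast
  have "norm (u \<phi>) \<le> max C 0 * test_seminorm N' \<phi>" if "\<phi> \<in> test_fun" "N \<le> N'" for \<phi> N'
    by (rule order_trans[OF CN[OF that(1)]])
      (intro mult_mono test_seminorm_mono test_seminorm_nonneg that, auto)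
  then show ?thesis by (intro that[of "max C 0" N]) auto
qed

lemma distribution_trig_poly_eqI:
  assumes "distribution u" "distribution v" "\<And>q. u (wave q) = v (wave q)"
  shows "trig_poly P \<Longrightarrow> u P = v P"
proof (induction rule: trig_poly.induct)
  case (wave c q)
  then show ?case using assms by (simp add: distribution_cmult test_fun_wave)
next
  case (add f g)
  then show ?case using assms(1,2) by (simp add: distribution_add trig_poly_test_fun)
qed

text \<open>By linearity the functionals agree on trigonometric polynomials, which are dense for a
  seminorm controlling both. Thus a distribution is determined by its Fourier coefficients.\<close>

lemma distribution_eqI:
  assumes u: "distribution u" and v: "distribution v" and eq: "\<And>q. u (wave q) = v (wave q)"
  shows "dist_eq u v"
  unfolding dist_eq_def
proof
  fix \<phi> assume \<phi>: "\<phi> \<in> test_fun"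
  obtain C N where C: "C \<ge> 0" "\<And>N' \<phi>. \<phi> \<in> test_fun \<Longrightarrow> N \<le> N' \<Longrightarrow> norm (u \<phi>) \<le> C * test_seminorm N' \<phi>"
    using distribution_bound[OF u] by blast
  obtain D K where D: "D \<ge> 0" "\<And>N' \<phi>. \<phi> \<in> test_fun \<Longrightarrow> K \<le> N' \<Longrightarrow> norm (v \<phi>) \<le> D * test_seminorm N' \<phi>"
    using distribution_bound[OF v] by blast
  have "norm (u \<phi> - v \<phi>) \<le> e" if "e > 0" for e
  proof -
    let ?s = "test_seminorm (max N K)"
    \<comment> \<open>The summand 1 keeps the denominator positive when both constants
      vanish.\<close>
    have "e / (C + D + 1) > 0" using C(1) D(1) that by simp
    then obtain P where P: "trig_poly P" "?s (\<lambda>p. \<phi> p - P p) < e / (C + D + 1)"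
      using trig_poly_dense[OF \<phi>] by blast
    note P' = trig_poly_test_fun[OF P(1)]
    note diff = test_fun_diff[OF \<phi> P']
    have "u \<phi> - v \<phi> = u (\<lambda>p. \<phi> p - P p) - v (\<lambda>p. \<phi> p - P p)"
      using distribution_diff[OF u \<phi> P'] distribution_diff[OF v \<phi> P']
        distribution_trig_poly_eqI[OF u v eq P(1)] by simp
    also have "norm \<dots> \<le> C * ?s (\<lambda>p. \<phi> p - P p) + D * ?s (\<lambda>p. \<phi> p - P p)"
      by (rule order_trans[OF norm_triangle_ineq4 add_mono[OF C(2)[OF diff] D(2)[OF diff]]]) auto
    also have "\<dots> \<le> (C + D + 1) * ?s (\<lambda>p. \<phi> p - P p)"
      using test_seminorm_nonneg[OF diff, of "max N K"] by (simp add: algebra_simps)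
    also have "\<dots> \<le> (C + D + 1) * (e / (C + D + 1))"
      using P(2) C(1) D(1) by (intro mult_left_mono) auto
    finally show ?thesis using C(1) D(1) by simp
  qed
  then have "norm (u \<phi> - v \<phi>) = 0"
    using field_le_epsilon[of "norm (u \<phi> - v \<phi>)" 0] norm_ge_zero[of "u \<phi> - v \<phi>"] by simp
  then show "u \<phi> = v \<phi>" by simp
qed

text \<open>The kernel in \<open>fourier_coeff\<close> carries a minus sign, so a coefficient tests
  \<open>u\<close> against the character of the opposite frequency.\<close>

lemma fourier_coeff_eq_wave: "fourier_coeff u \<tau> \<xi> = u (wave (- \<tau>, - \<xi>)) / of_real ((2 * pi)\<^sup>2)"
proof -
  have "(\<lambda>(t, x). exp (- \<i> * of_real (t * of_int \<tau> + x * of_int \<xi>))) = wave (- \<tau>, - \<xi>)"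
    unfolding wave_def fun_eq_iff by (auto simp: algebra_simps intro!: arg_cong[where f = exp])
  then show ?thesis by (simp only: fourier_coeff_def)
qed

section \<open>Functions as distributions, and integration by parts\<close>

abbreviation torus_box :: "(real \<times> real) set" where
  "torus_box \<equiv> cbox (0, 0) (2 * pi, 2 * pi)"

lemma content_torus_box: "measure lborel torus_box = (2 * pi)\<^sup>2"
  by (simp add: content_Pair power2_eq_square)

lemma integrable_torus_box:
  fixes g :: "real \<times> real \<Rightarrow> complex"
  shows "continuous_on UNIV g \<Longrightarrow> g integrable_on torus_box"
  by (intro integrable_continuous) (auto intro: continuous_on_subset)

lemma distribution_dist_of_fun:
  assumes "periodic2 g" "continuous_on UNIV g"
  shows "distribution (dist_of_fun g)"
proof -
  obtain p0 where p0: "\<And>q. norm (g q) \<le> norm (g p0)" using periodic2_attains_max[OF assms] by blast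
  show ?thesis
    unfolding distribution_def
  proof (intro conjI ballI allI exI)
    fix \<phi> assume \<phi>: "\<phi> \<in> test_fun"
    have i: "(\<lambda>p. g p * \<phi> p) integrable_on torus_box" if "\<phi> \<in> test_fun" for \<phi>
      by (intro integrable_torus_box continuous_intros assms test_fun_continuous that)
    show "dist_of_fun g (\<lambda>p. \<phi> p + \<psi> p) = dist_of_fun g \<phi> + dist_of_fun g \<psi>" if "\<psi> \<in> test_fun" for \<psi>
      unfolding dist_of_fun_def distrib_left by (rule integral_add[OF i[OF \<phi>] i[OF that]])
    show "dist_of_fun g (\<lambda>p. c * \<phi> p) = c * dist_of_fun g \<phi>" for c
      unfolding dist_of_fun_def by (simp add: mult.left_commute)
    have "norm (dist_of_fun g \<phi>) \<le> (norm (g p0) * test_seminorm 0 \<phi>) * measure lborel torus_box"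
      unfolding dist_of_fun_def
    proof (rule has_integral_bound)
      show "((\<lambda>p. g p * \<phi> p) has_integral integral torus_box (\<lambda>p. g p * \<phi> p)) torus_box"
        using i[OF \<phi>] by (rule integrable_integral)
      show "norm (g p * \<phi> p) \<le> norm (g p0) * test_seminorm 0 \<phi>" for p
        unfolding norm_mult by (intro mult_mono p0 norm_le_test_seminorm \<phi>) auto
    qed (intro mult_nonneg_nonneg test_seminorm_nonneg \<phi>, auto)
    then show "cmod (dist_of_fun g \<phi>) \<le> (norm (g p0) * measure lborel torus_box) * test_seminorm 0 \<phi>"
      by (simp add: mult_ac)
  qed
qed

text \<open>\<open>\<phi>\<close> is bounded on the compact square, so the M-test makes the products
  converge uniformly there and the sum may be exchanged with the integral.\<close>

lemma dist_of_fun_sums: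
  assumes G: "\<And>i::nat. continuous_on UNIV (G i)" "\<And>i p. norm (G i p) \<le> M i" and M: "summable M"
    and \<phi>: "continuous_on UNIV \<phi>"
  shows "(\<lambda>i. dist_of_fun (G i) \<phi>) sums dist_of_fun (\<lambda>p. \<Sum>i. G i p) \<phi>"
proof -
  have "compact (\<phi> ` torus_box)"
    by (intro compact_continuous_image continuous_on_subset[OF \<phi>]) auto
  then obtain B where B: "\<And>p. p \<in> torus_box \<Longrightarrow> norm (\<phi> p) \<le> B"
    using compact_imp_bounded[of "\<phi> ` torus_box"] unfolding bounded_iff by blast
  have sG: "summable (\<lambda>i. G i p)" for p
    using G(2) by (intro summable_comparison_test'[OF M, of 0])
  have "uniform_limit torus_box (\<lambda>n p. \<Sum>i<n. G i p * \<phi> p) (\<lambda>p. \<Sum>i. G i p * \<phi> p) sequentially"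
  proof (rule Weierstrass_m_test)
    show "norm (G i p * \<phi> p) \<le> M i * B" if "p \<in> torus_box" for i p
      unfolding norm_mult using G(2)[of i p] B[OF that] order_trans[OF norm_ge_zero G(2)] by (intro mult_mono) auto
    show "summable (\<lambda>i. M i * B)" by (rule summable_mult2[OF M])
  qed
  then have u: "uniform_limit torus_box (\<lambda>n p. \<Sum>i<n. G i p * \<phi> p) (\<lambda>p. (\<Sum>i. G i p) * \<phi> p) sequentially"
    by (simp add: suminf_mult2[OF sG])
  have c: "continuous_on torus_box (\<lambda>p. G i p * \<phi> p)" for i
    by (intro continuous_intros continuous_on_subset[OF G(1)] continuous_on_subset[OF \<phi>]) auto
  have c': "continuous_on torus_box (\<lambda>p. \<Sum>i<n. G i p * \<phi> p)" for n
    by (intro continuous_on_sum c)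
  from uniform_limit_integral_cbox[OF u c'] obtain I J where IJ:
    "\<And>n. ((\<lambda>p. \<Sum>i<n. G i p * \<phi> p) has_integral I n) torus_box"
    "((\<lambda>p. (\<Sum>i. G i p) * \<phi> p) has_integral J) torus_box" "I \<longlonglongrightarrow> J" by auto
  have "I n = (\<Sum>i<n. dist_of_fun (G i) \<phi>)" for n
    using integral_unique[OF IJ(1)[of n]] integral_sum[of "{..<n}" "\<lambda>i p. G i p * \<phi> p" torus_box]
      integrable_continuous[OF c] by (simp add: dist_of_fun_def)
  then have "I = (\<lambda>n. \<Sum>i<n. dist_of_fun (G i) \<phi>)" by (rule ext)
  moreover have "J = dist_of_fun (\<lambda>p. \<Sum>i. G i p) \<phi>"
    using integral_unique[OF IJ(2)] by (simp add: dist_of_fun_def)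
  ultimately show ?thesis using IJ(3) by (simp add: sums_def)
qed

text \<open>The fundamental theorem over one period. The iterated integral has \<open>x\<close>
  innermost, so the order must be swapped first; for \<open>x\<close>-derivatives this is already
  the right order.\<close>

lemma integral_partial_t_periodic:
  assumes "\<And>t x. ((\<lambda>s. H (s, x)) has_vector_derivative H' (t, x)) (at t)"
    and H': "continuous_on UNIV H'" and H: "periodic2 H"
  shows "integral torus_box H' = 0"
proof -
  have c: "continuous_on torus_box (\<lambda>(t, x). H' (t, x))"
    using H' by (auto intro: continuous_on_subset)
  have "integral (cbox 0 (2 * pi)) (\<lambda>t. H' (t, x)) = 0" for x
  proof -
    have "((\<lambda>t. H' (t, x)) has_integral H (2 * pi, x) - H (0, x)) {0..2 * pi}"
      by (rule fundamental_theorem_of_calculus[OF _ has_vector_derivative_at_within[OF assms(1)]]) simp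
    moreover have "H (2 * pi, x) = H (0, x)" using H unfolding periodic2_def by (metis add_0)
    ultimately show ?thesis by (auto simp: integral_unique)
  qed
  then have "integral (cbox 0 (2 * pi)) (\<lambda>t. integral (cbox 0 (2 * pi)) (\<lambda>x. H' (t, x))) = 0"
    using integral_swap_continuous[OF c] by simp
  then show ?thesis using integral_prod_continuous[OF c] by simp
qed

lemma integral_partial_x_periodic:
  assumes "\<And>t x. ((\<lambda>y. H (t, y)) has_vector_derivative H' (t, x)) (at x)"
    and H': "continuous_on UNIV H'" and H: "periodic2 H"
  shows "integral torus_box H' = 0"
proof -
  have c: "continuous_on torus_box (\<lambda>(t, x). H' (t, x))"
    using H' by (auto intro: continuous_on_subset)
  have "integral (cbox 0 (2 * pi)) (\<lambda>x. H' (t, x)) = 0" for t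
  proof -
    have "((\<lambda>x. H' (t, x)) has_integral H (t, 2 * pi) - H (t, 0)) {0..2 * pi}"
      by (rule fundamental_theorem_of_calculus[OF _ has_vector_derivative_at_within[OF assms(1)]]) simp
    moreover have "H (t, 2 * pi) = H (t, 0)" using H unfolding periodic2_def by (metis add_0)
    ultimately show ?thesis by (auto simp: integral_unique)
  qed
  then show ?thesis using integral_prod_continuous[OF c] by simp
qed

text \<open>As \<open>a\<close> is constant in \<open>x\<close>, \<open>f W + V g\<close> is the
  \<open>t\<close>-derivative of \<open>V W\<close> minus the \<open>x\<close>-derivative of
  \<open>a V W\<close>, and both integrate to zero over a period.\<close>

lemma dist_of_fun_transport_adjoint:
  fixes a :: "real \<Rightarrow> real"
  assumes a: "continuous_on UNIV a" "\<And>t. a (t + 2 * pi) = a t" and VW: "V \<in> test_fun" "W \<in> test_fun"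
    and f: "\<And>p. partial_t V p - of_real (a (fst p)) * partial_x V p = f p"
    and g: "\<And>p. partial_t W p - of_real (a (fst p)) * partial_x W p = g p"
  shows "dist_of_fun f W = - dist_of_fun V g"
proof -
  note D = VW[THEN test_fun_has_partial_t] VW[THEN test_fun_has_partial_x]
  note c = VW[THEN test_fun_continuous] VW[THEN test_fun_partial_t, THEN test_fun_continuous]
    VW[THEN test_fun_partial_x, THEN test_fun_continuous]
  note per = VW[THEN test_fun_periodic2]
  have ac: "continuous_on UNIV (\<lambda>p :: real \<times> real. complex_of_real (a (fst p)))"
    by (intro continuous_intros continuous_on_compose2[OF a(1)]) auto
  let ?A = "\<lambda>p. V p * partial_t W p + partial_t V p * W p"
  let ?B = "\<lambda>p. of_real (a (fst p)) * (V p * partial_x W p + partial_x V p * W p)"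
  have cA: "continuous_on UNIV ?A" and cB: "continuous_on UNIV ?B"
    by (intro continuous_intros c ac)+
  have A: "integral torus_box ?A = 0"
  proof (rule integral_partial_t_periodic[of "\<lambda>p. V p * W p"])
    show "((\<lambda>s. V (s, x) * W (s, x)) has_vector_derivative ?A (t, x)) (at t)" for t x
      by (rule has_vector_derivative_mult[OF D(1,2)])
  qed (use cA per in \<open>auto simp: periodic2_def\<close>)
  have B: "integral torus_box ?B = 0"
  proof (rule integral_partial_x_periodic[of "\<lambda>p. of_real (a (fst p)) * (V p * W p)"])
    show "((\<lambda>y. of_real (a (fst (t, y))) * (V (t, y) * W (t, y))) has_vector_derivative ?B (t, x)) (at x)" for t x
      unfolding fst_conv by (intro has_vector_derivative_mult_right has_vector_derivative_mult D)
  qed (use cB per a in \<open>auto simp: periodic2_def\<close>)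
  have fW: "f p * W p = (?A p - ?B p) - V p * g p" for p
    unfolding f[symmetric] g[symmetric] by (simp add: algebra_simps)
  have g': "g = (\<lambda>p. partial_t W p - of_real (a (fst p)) * partial_x W p)" using g by auto
  have "continuous_on UNIV g" unfolding g' by (intro continuous_intros c ac)
  then have cVg: "continuous_on UNIV (\<lambda>p. V p * g p)" by (intro continuous_intros c)
  show ?thesis
    unfolding dist_of_fun_def fW
    using integral_diff[OF integrable_diff[OF integrable_torus_box[OF cA] integrable_torus_box[OF cB]] integrable_torus_box[OF cVg]]
      integral_diff[OF integrable_torus_box[OF cA] integrable_torus_box[OF cB]] A B by simp
qed

section \<open>Solving the transport equation for a single frequency\<close>

lemma continuous_antiderivative:
  fixes f :: "real \<Rightarrow> 'a::euclidean_space"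
  assumes "continuous_on UNIV f"
  obtains F where "\<And>t. (F has_vector_derivative f t) (at t)" "F 0 = 0"
proof -
  have "isCont f x" for x using assms by (simp add: continuous_on_eq_continuous_at)
  then have "\<exists>F. \<forall>x::real. - \<infinity> < ereal x \<longrightarrow> ereal x < \<infinity> \<longrightarrow> (F has_vector_derivative f x) (at x)"
    by (intro einterval_antiderivative) auto
  then obtain F where F: "\<And>x. (F has_vector_derivative f x) (at x)" by auto
  have "((\<lambda>t. F t - F 0) has_vector_derivative f t - 0) (at t)" for t
    by (intro has_vector_derivative_diff F has_vector_derivative_const)
  then show ?thesis by (intro that[of "\<lambda>t. F t - F 0"]) auto
qed

lemma has_vector_derivative_zero_imp_const:
  fixes f :: "real \<Rightarrow> 'a::real_normed_vector"
  assumes "\<And>t. (f has_vector_derivative 0) (at t)"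
  shows "f t = f s"
proof -
  obtain c where "\<And>x. f x = c"
    using has_vector_derivative_zero_constant[of UNIV f] assms by auto
  then show ?thesis by simp
qed

text \<open>
  Variation of constants: \<open>E = e\<^bsup>i\<xi>B\<^esup> (K + J)\<close> with \<open>B' = a\<close> and \<open>J' = e\<^bsup>-i\<xi>B\<^esup> h\<close>,
  where \<open>K\<close> is chosen to make \<open>E\<close> periodic.
\<close>

lemma periodic_transport_ode:
  fixes a :: "real \<Rightarrow> real" and h :: "real \<Rightarrow> complex" and \<xi> a0 :: real
  assumes a: "continuous_on UNIV a" "\<And>t. a (t + 2 * pi) = a t"
    and a0: "a0 = 1 / (2 * pi) * integral {0..2 * pi} a"
    and h: "continuous_on UNIV h" "\<And>t. h (t + 2 * pi) = h t" "\<And>t. norm (h t) \<le> 1"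
    and \<omega>: "exp (\<i> * of_real (2 * pi * a0 * \<xi>)) \<noteq> 1"
  obtains E where "\<And>t. (E has_vector_derivative \<i> * of_real (\<xi> * a t) * E t + h t) (at t)"
    "\<And>t. E (t + 2 * pi) = E t"
    "\<And>t. norm (E t) \<le> 6 * pi / norm (exp (\<i> * of_real (2 * pi * a0 * \<xi>)) - 1)"
proof -
  define \<omega> where "\<omega> = exp (\<i> * of_real (2 * pi * a0 * \<xi>))"
  have n\<omega>: "norm \<omega> = 1" by (simp add: \<omega>_def)
  obtain B where B: "\<And>t. (B has_vector_derivative a t) (at t)" "B 0 = 0"
    using continuous_antiderivative[OF a(1)] by blast
  have Bp: "B (t + 2 * pi) = B t + 2 * pi * a0" for t
  proof -
    have "((\<lambda>t. B (t + 2 * pi) - B t) has_vector_derivative 0) (at t)" for t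
      using has_vector_derivative_diff[OF iffD1[OF has_vector_derivative_translate B(1)[of "t + 2 * pi"]] B(1)[of t]]
      by (simp add: a(2))
    from has_vector_derivative_zero_imp_const[OF this, of t 0]
    have "B (t + 2 * pi) - B t = B (2 * pi)" using B(2) by simp
    moreover have "(a has_integral B (2 * pi) - B 0) {0..2 * pi}"
      by (rule fundamental_theorem_of_calculus[OF _ has_vector_derivative_at_within[OF B(1)]]) simp
    then have "integral {0..2 * pi} a = B (2 * pi)" using B(2) by (simp add: integral_unique)
    ultimately show ?thesis using a0 by simp
  qed
  define e where "e t = exp (\<i> * of_real (\<xi> * B t))" for t
  have ne: "norm (e t) = 1" and e0: "e t \<noteq> 0" for t by (simp_all add: e_def)
  \<comment> \<open>\<open>\<omega>\<close> is the Floquet multiplier of the homogeneous equation;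
    its distance to 1 is the divisor in \<open>K\<close>.\<close>
  have ep: "e (t + 2 * pi) = \<omega> * e t" for t
  proof -
    have "\<i> * of_real (\<xi> * B (t + 2 * pi)) = \<i> * of_real (2 * pi * a0 * \<xi>) + \<i> * of_real (\<xi> * B t)"
      unfolding Bp by (simp add: algebra_simps)
    then show ?thesis by (simp only: e_def \<omega>_def exp_add)
  qed
  have e': "(e has_vector_derivative \<i> * of_real (\<xi> * a t) * e t) (at t)" for t
  proof -
    have "((\<lambda>t. \<xi> * B t) has_vector_derivative \<xi> * a t) (at t)"
      by (rule has_vector_derivative_mult_right[OF B(1)])
    then have "((\<lambda>t. \<i> * of_real (\<xi> * B t)) has_vector_derivative \<i> * of_real (\<xi> * a t)) (at t)"
      by (intro has_vector_derivative_mult_right has_vector_derivative_of_real)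
        (simp add: has_real_derivative_iff_has_vector_derivative)
    then have "((exp \<circ> (\<lambda>t. \<i> * of_real (\<xi> * B t))) has_vector_derivative
        \<i> * of_real (\<xi> * a t) * exp (\<i> * of_real (\<xi> * B t))) (at t)"
      by (rule field_vector_diff_chain_at[OF _ DERIV_exp])
    then show ?thesis by (simp add: e_def[abs_def] o_def)
  qed
  have ec: "continuous_on UNIV e"
    by (intro continuous_at_imp_continuous_on ballI has_vector_derivative_continuous[OF e'])
  have "continuous_on UNIV (\<lambda>t. inverse (e t) * h t)"
    by (intro continuous_intros ec h(1)) (simp add: e0)
  then obtain J where J: "\<And>t. (J has_vector_derivative inverse (e t) * h t) (at t)" "J 0 = 0"
    using continuous_antiderivative by blast
  have Jp: "J (t + 2 * pi) = J (2 * pi) + inverse \<omega> * J t" for t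
  proof -
    have "((\<lambda>t. J (t + 2 * pi) - inverse \<omega> * J t) has_vector_derivative
        inverse (e (t + 2 * pi)) * h (t + 2 * pi) - inverse \<omega> * (inverse (e t) * h t)) (at t)" for t
      by (intro has_vector_derivative_diff has_vector_derivative_mult_right J(1)
          iffD1[OF has_vector_derivative_translate])
    then have "((\<lambda>t. J (t + 2 * pi) - inverse \<omega> * J t) has_vector_derivative 0) (at t)" for t
      by (simp add: ep h(2) mult.assoc)
    from has_vector_derivative_zero_imp_const[OF this, of t 0] show ?thesis using J(2) by (simp add: diff_eq_eq)
  qed
  have Jle: "norm (J t) \<le> 2 * pi" if "t \<in> {0..2 * pi}" for t
  proof -
    have "((\<lambda>t. inverse (e t) * h t) has_integral J t - J 0) {0..t}"
      using that by (intro fundamental_theorem_of_calculus[OF _ has_vector_derivative_at_within[OF J(1)]]) simp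
    then have "norm (J t - J 0) \<le> 1 * measure lborel (cbox 0 t)"
      using h(3) by (intro has_integral_bound[of 1 "\<lambda>t. inverse (e t) * h t"]) (auto simp: norm_mult norm_inverse ne)
    then show ?thesis using that J(2) by simp
  qed
  define K where "K = \<omega> * J (2 * pi) / (1 - \<omega>)"
  define E where "E t = e t * (K + J t)" for t
  have w1: "\<omega> \<noteq> 1" "norm (\<omega> - 1) > 0" using \<omega> by (simp_all add: \<omega>_def)
  have w0: "\<omega> \<noteq> 0" by (simp add: \<omega>_def)
  have "K * (1 - \<omega>) = \<omega> * J (2 * pi)" using w1(1) by (simp add: K_def)
  then have K: "\<omega> * (K + J (2 * pi)) = K"
    unfolding distrib_left by (metis right_diff_distrib mult.right_neutral mult.commute add.commute diff_add_cancel)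
  have Ep: "E (t + 2 * pi) = E t" for t
  proof -
    have "E (t + 2 * pi) = e t * (\<omega> * (K + J (2 * pi)) + \<omega> * inverse \<omega> * J t)"
      unfolding E_def ep Jp by (simp add: algebra_simps)
    then show ?thesis using w0 by (simp add: K E_def)
  qed
  \<comment> \<open>Of \<open>6 * pi\<close>, the part \<open>2 * pi\<close> comes from
    \<open>K\<close>. The remaining \<open>4 * pi\<close> comes from \<open>J\<close>, whose bound
    \<open>2 * pi\<close> is brought to the same denominator by
    \<open>norm (\<omega> - 1) \<le> 2\<close>.\<close>
  have E0: "norm (E t) \<le> 6 * pi / norm (\<omega> - 1)" if "t \<in> {0..2 * pi}" for t
  proof -
    have "norm K \<le> 2 * pi / norm (\<omega> - 1)"
      using divide_right_mono[OF Jle[of "2 * pi"], of "norm (\<omega> - 1)"]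
      by (simp add: K_def norm_mult norm_divide n\<omega> norm_minus_commute[of 1])
    moreover have "norm (\<omega> - 1) \<le> 2" using norm_triangle_ineq4[of \<omega> 1] n\<omega> by simp
    then have "2 * pi \<le> 4 * pi / norm (\<omega> - 1)"
      using mult_left_mono[of "norm (\<omega> - 1)" 2 "2 * pi"] w1(2) by (simp add: pos_le_divide_eq)
    then have "norm (J t) \<le> 4 * pi / norm (\<omega> - 1)" using Jle[OF that] by linarith
    ultimately have "norm (K + J t) \<le> 2 * pi / norm (\<omega> - 1) + 4 * pi / norm (\<omega> - 1)"
      by (rule norm_triangle_mono)
    then show ?thesis by (simp add: E_def norm_mult ne add_divide_distrib[symmetric])
  qed
  show ?thesis
  proof (rule that[of E])
    have "(E has_vector_derivative e t * (inverse (e t) * h t) + \<i> * of_real (\<xi> * a t) * e t * (K + J t)) (at t)" for t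
      unfolding E_def[abs_def]
      by (rule has_vector_derivative_mult[OF e'])
        (use has_vector_derivative_add[OF has_vector_derivative_const J(1)] in simp)
    moreover have "e t * (inverse (e t) * h t) = h t" for t
      using e0[of t] by (simp flip: mult.assoc)
    then have "e t * (inverse (e t) * h t) + \<i> * of_real (\<xi> * a t) * e t * (K + J t) =
        \<i> * of_real (\<xi> * a t) * E t + h t" for t
      unfolding E_def mult.assoc by (simp only: add.commute)
    ultimately show "(E has_vector_derivative \<i> * of_real (\<xi> * a t) * E t + h t) (at t)" for t
      by simp
    show "norm (E t) \<le> 6 * pi / norm (exp (\<i> * of_real (2 * pi * a0 * \<xi>)) - 1)" for t
    proof -
      obtain i :: int and s where s: "t = s + 2 * pi * of_int i" "s \<in> {0..2 * pi}" by (rule periodic_rep)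
      have "periodic2 (\<lambda>p. E (fst p))" using Ep by (simp add: periodic2_def)
      from periodic2_shift[OF this, of s i] have "E t = E s" using s(1) by simp
      then show ?thesis using E0[OF s(2)] by (simp add: \<omega>_def)
    qed
  qed (rule Ep)
qed

section \<open>Derivative bounds for single-frequency solutions\<close>

lemma Cbound_zero: "M \<ge> 0 \<Longrightarrow> \<Lambda> \<ge> 0 \<Longrightarrow> Cbound n \<Lambda> M (\<lambda>p. 0)"
  using Cbound_mono[OF Cbound_cmult[OF Cbound_wave[of 0 \<Lambda> n], of 0], of M] by simp

lemma smooth_circle_deriv_periodic:
  assumes "smooth_circle a"
  shows "(deriv ^^ j) a (t + 2 * pi) = (deriv ^^ j) a t"
proof (induction j arbitrary: t)
  case 0
  then show ?case using assms by (simp add: smooth_circle_def)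
next
  case (Suc j)
  have "deriv ((deriv ^^ j) a) (t + 2 * pi) = deriv (\<lambda>s. (deriv ^^ j) a (s + 2 * pi)) t"
    unfolding deriv_def has_real_derivative_iff_has_vector_derivative has_vector_derivative_translate ..
  then show ?case by (simp add: Suc)
qed

lemma smooth_circle_has_deriv:
  assumes "smooth_circle a"
  shows "((deriv ^^ j) a has_real_derivative (deriv ^^ Suc j) a t) (at t)"
  using assms by (simp add: smooth_circle_def DERIV_deriv_iff_real_differentiable differentiable_on_def)

text \<open>Each derivative of \<open>a\<close> is bounded by periodicity, and factors
  \<open>\<Lambda> \<ge> 1\<close> only relax the requirement, so one constant serves every
  \<open>\<Lambda>\<close>; it is applied with \<open>bracket q\<close>. The induction keeps
  \<open>j\<close> arbitrary because a \<open>t\<close>-derivative raises it.\<close>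

lemma smooth_circle_Cbound:
  assumes "smooth_circle a"
  shows "\<exists>A\<ge>0. \<forall>\<Lambda>\<ge>1. Cbound n \<Lambda> A (\<lambda>(t, x). of_real ((deriv ^^ j) a t))"
proof (induction n arbitrary: j)
  let ?g = "\<lambda>j (t :: real, x :: real). complex_of_real ((deriv ^^ j) a t)"
  have c: "continuous_on UNIV (?g j)" for j
  proof -
    have "continuous_on UNIV ((deriv ^^ j) a)"
      using assms by (simp add: smooth_circle_def differentiable_imp_continuous_on)
    from continuous_on_compose2[OF this continuous_on_fst[OF continuous_on_id]] show ?thesis
      unfolding case_prod_unfold by (intro continuous_on_of_real) simp
  qed
  have p: "periodic2 (?g j)" for j
    by (simp add: periodic2_def smooth_circle_deriv_periodic[OF assms])
  {
    case 0
    obtain p0 where "\<And>q. norm (?g j q) \<le> norm (?g j p0)" using periodic2_attains_max[OF p c] by blast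
    then show ?case using c[of j] by (intro exI[of _ "norm (?g j p0)"]) auto
  next
    case (Suc n)
    obtain A where A: "A \<ge> 0" "\<And>\<Lambda>. \<Lambda> \<ge> 1 \<Longrightarrow> Cbound n \<Lambda> A (?g (Suc j))"
      using Suc[of "Suc j"] by auto
    obtain p0 where p0: "\<And>q. norm (?g j q) \<le> norm (?g j p0)" using periodic2_attains_max[OF p c] by blast
    let ?M = "A + norm (?g j p0)"
    have "Cbound (Suc n) \<Lambda> ?M (?g j)" if \<Lambda>: "\<Lambda> \<ge> 1" for \<Lambda>
    proof (rule Cbound_SucI)
      show "norm (?g j p) \<le> ?M" for p using p0[of p] A(1) by linarith
      show "((\<lambda>s. ?g j (s, x)) has_vector_derivative ?g (Suc j) (t, x)) (at t)" for t x
        using smooth_circle_has_deriv[OF assms, of j t]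
        by (simp add: has_real_derivative_iff_has_vector_derivative has_vector_derivative_of_real)
      show "((\<lambda>y. ?g j (t, y)) has_vector_derivative 0) (at x)" for t x by simp
      have "A * 1 \<le> ?M * \<Lambda>" using A(1) \<Lambda> by (intro mult_mono) auto
      then show "Cbound n \<Lambda> (?M * \<Lambda>) (?g (Suc j))"
        using Cbound_mono[OF A(2)[OF \<Lambda>]] \<Lambda> by simp
      show "Cbound n \<Lambda> (?M * \<Lambda>) (\<lambda>p. 0)" using A(1) \<Lambda> by (intro Cbound_zero) auto
    qed (rule c)
    then show ?case using A(1) by (intro exI[of _ ?M]) auto
  }
qed

definition bracket :: "int \<times> int \<Rightarrow> real" where
  "bracket q = japanese_bracket (real_of_int (fst q), real_of_int (snd q))"

lemma bracket_eq: "bracket q = sqrt (1 + (real_of_int (fst q))\<^sup>2 + (real_of_int (snd q))\<^sup>2)"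
  by (simp add: bracket_def japanese_bracket_def norm_Pair)

lemma bracket_ge:
  "bracket q \<ge> 1" "bracket q \<ge> \<bar>of_int (fst q)\<bar>" "bracket q \<ge> \<bar>of_int (snd q)\<bar>"
  unfolding bracket_eq by (auto intro!: real_le_rsqrt)

text \<open>Inserting the differential equation expresses the \<open>t\<close>-derivative through
  the mode itself and a character. Higher derivatives of \<open>E\<close> therefore never have to be
  named.\<close>

lemma transport_mode_has_partials:
  fixes a :: "real \<Rightarrow> real"
  defines "V \<equiv> \<lambda>q E (p :: real \<times> real). E (fst p) * wave (0, snd q) p :: complex"
  assumes "\<And>t. (E has_vector_derivative
      \<i> * of_real (of_int (snd q) * a t) * E t + exp (\<i> * of_real (t * of_int (fst q)))) (at t)"
  shows "((\<lambda>s. V q E (s, x)) has_vector_derivative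
      \<i> * of_int (snd q) * (of_real (a t) * V q E (t, x)) + wave q (t, x)) (at t)"
    and "((\<lambda>y. V q E (t, y)) has_vector_derivative \<i> * of_int (snd q) * V q E (t, x)) (at x)"
proof -
  show "((\<lambda>y. V q E (t, y)) has_vector_derivative \<i> * of_int (snd q) * V q E (t, x)) (at x)"
    using has_vector_derivative_mult_right[OF has_partial_x_wave[of "(0, snd q)" t x], of "E t"]
    by (simp add: V_def mult_ac)
  have w: "exp (\<i> * of_real (t * of_int (fst q))) * wave (0, snd q) (t, x) = wave q (t, x)"
    by (simp add: wave_def distrib_left exp_add)
  have "((\<lambda>s. E s * wave (0, snd q) (t, x)) has_vector_derivative
     (\<i> * of_real (of_int (snd q) * a t) * E t + exp (\<i> * of_real (t * of_int (fst q)))) * wave (0, snd q) (t, x)) (at t)"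
    by (intro has_vector_derivative_mult_left assms)
  moreover have "(\<lambda>s. V q E (s, x)) = (\<lambda>s. E s * wave (0, snd q) (t, x))"
    by (simp add: V_def wave_def)
  moreover have "(\<i> * of_real (of_int (snd q) * a t) * E t) * wave (0, snd q) (t, x)
      = \<i> * of_int (snd q) * (of_real (a t) * V q E (t, x))"
    by (simp add: V_def)
  ultimately show "((\<lambda>s. V q E (s, x)) has_vector_derivative
      \<i> * of_int (snd q) * (of_real (a t) * V q E (t, x)) + wave q (t, x)) (at t)"
    unfolding distrib_right w by (simp only:)
qed

text \<open>\<open>D\<close> depends only on \<open>n\<close> and \<open>a\<close>: the equation
  trades each derivative for multiplication by the frequency and by \<open>a\<close>, plus a
  character, so only the supremum bound \<open>M\<close> of \<open>E\<close> enters.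
  \<open>M \<ge> 1\<close> lets the character, of size 1, be absorbed.\<close>

lemma transport_mode_Cbound:
  assumes "smooth_circle a"
  shows "\<exists>D\<ge>1. \<forall>q E M.
     (\<forall>t. (E has_vector_derivative \<i> * of_real (of_int (snd q) * a t) * E t + exp (\<i> * of_real (t * of_int (fst q)))) (at t)) \<longrightarrow>
     (\<forall>t. norm (E t) \<le> M) \<longrightarrow> M \<ge> 1 \<longrightarrow>
     Cbound n (bracket q) (D * M) (\<lambda>p. E (fst p) * wave (0, snd q) p)"
proof (induction n)
  let ?V = "\<lambda>q E (p :: real \<times> real). E (fst p) * wave (0, snd q) p :: complex"
  let ?P = "\<lambda>q E. \<forall>t. (E has_vector_derivative
    \<i> * of_real (of_int (snd q) * a t) * E t + exp (\<i> * of_real (t * of_int (fst q)))) (at t)"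
  have c: "continuous_on UNIV (?V q E)" if "?P q E" for q E
  proof -
    have "continuous_on UNIV E"
      using that by (intro continuous_at_imp_continuous_on ballI) (blast intro: has_vector_derivative_continuous)
    from continuous_on_compose2[OF this continuous_on_fst[OF continuous_on_id]] show ?thesis
      by (intro continuous_on_mult continuous_wave) simp
  qed
  {
    case 0
    show ?case using c by (intro exI[of _ 1]) (auto simp: norm_mult)
  next
    case (Suc n)
    then obtain D where D: "D \<ge> 1" "\<And>q E M. ?P q E \<Longrightarrow> \<forall>t. norm (E t) \<le> M \<Longrightarrow> M \<ge> 1 \<Longrightarrow> Cbound n (bracket q) (D * M) (?V q E)"
      by blast
    obtain A where A: "A \<ge> 0" "\<And>\<Lambda>. \<Lambda> \<ge> 1 \<Longrightarrow> Cbound n \<Lambda> A (\<lambda>(t, x). of_real (a t))"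
      using smooth_circle_Cbound[OF assms, of n 0] by auto
    \<comment> \<open>The three summands cover, in order, \<open>a\<close> times the mode, the
      character, and the mode itself in the \<open>x\<close>-derivative.\<close>
    let ?D = "2 ^ n * A * D + 1 + D"
    have "Cbound (Suc n) (bracket q) (?D * M) (?V q E)"
      if P: "?P q E" and M: "\<forall>t. norm (E t) \<le> M" "M \<ge> 1" for q E M
    proof (rule Cbound_SucI)
      let ?\<xi> = "complex_of_int (snd q)" and ?a = "\<lambda>(t, x::real). complex_of_real (a t)"
      note b = bracket_ge[of q]
      have b0: "bracket q \<ge> 0" using b(1) by simp
      show "continuous_on UNIV (?V q E)" by (rule c[OF P])
      have "1 * M \<le> ?D * M"
        using A(1) D(1) M(2) by (intro mult_right_mono) auto
      then show "norm (?V q E p) \<le> ?D * M" for p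
        using M(1)[rule_format, of "fst p"] by (simp add: norm_mult)
      note D' = transport_mode_has_partials[of E q a, OF P[rule_format]]
      show "((\<lambda>s. ?V q E (s, x)) has_vector_derivative
          (\<i> * ?\<xi> * (?a (t, x) * ?V q E (t, x)) + wave q (t, x))) (at t)" for t x
        using D'(1)[of x t] unfolding prod.case .
      show "((\<lambda>y. ?V q E (t, y)) has_vector_derivative \<i> * ?\<xi> * ?V q E (t, x)) (at x)" for t x
        by (rule D'(2))
      have V: "Cbound n (bracket q) (D * M) (?V q E)" by (rule D(2)[OF P M])
      have le: "D * M \<le> ?D * M" using A(1) D(1) M(2) by (intro mult_right_mono) auto
      have "Cbound n (bracket q) (norm (\<i> * ?\<xi>) * (D * M)) (\<lambda>p. \<i> * ?\<xi> * ?V q E p)"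
        by (rule Cbound_cmult[OF V])
      moreover have "norm (\<i> * ?\<xi>) * (D * M) \<le> bracket q * (?D * M)"
        using b b0 le D(1) M(2) by (intro mult_mono) (auto simp: norm_mult)
      ultimately show "Cbound n (bracket q) (?D * M * bracket q) (\<lambda>p. \<i> * ?\<xi> * ?V q E p)"
        using Cbound_mono[OF _ _ b0] by (simp only: mult.commute)
      have "Cbound n (bracket q) (norm (\<i> * ?\<xi>) * (2 ^ n * A * (D * M)) + 1)
          (\<lambda>p. \<i> * ?\<xi> * (?a p * ?V q E p) + wave q p)"
        by (intro Cbound_add Cbound_cmult Cbound_mult A(2) b b0 V Cbound_wave)
      moreover have "norm (\<i> * ?\<xi>) * (2 ^ n * A * (D * M)) + 1 \<le> ?D * M * bracket q"
      proof -
        have "norm (\<i> * ?\<xi>) * (2 ^ n * A * (D * M)) \<le> bracket q * (2 ^ n * A * (D * M))"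
          using b A(1) D(1) M(2) by (intro mult_right_mono) (auto simp: norm_mult)
        moreover have "1 * 1 \<le> bracket q * M" using b M(2) by (intro mult_mono) auto
        moreover have "0 \<le> bracket q * (D * M)" using b0 D(1) M(2) by simp
        ultimately show ?thesis by (simp add: algebra_simps)
      qed
      ultimately show "Cbound n (bracket q) (?D * M * bracket q)
          (\<lambda>p. \<i> * ?\<xi> * (?a p * ?V q E p) + wave q p)"
        by (rule Cbound_mono[OF _ _ b0])
    qed
    moreover have "?D \<ge> 1" using A(1) D(1) by simp
    ultimately show ?case by blast
  }
qed

section \<open>Small divisors\<close>

text \<open>Up to \<open>pi / 3\<close> the slope \<open>cos\<close> is at least 1/2; beyond it the
  sine is at least \<open>sqrt 3 / 2\<close>, which exceeds 2/3, while \<open>x / 3\<close> stays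
  below 2/3.\<close>

lemma abs_sin_ge:
  assumes "\<bar>x\<bar> \<le> pi / 2"
  shows "\<bar>x\<bar> / 3 \<le> \<bar>sin x\<bar>"
proof -
  have *: "x / 3 \<le> sin x" if x: "0 \<le> x" "x \<le> pi / 2" for x :: real
  proof (cases "x \<le> pi / 3")
    case True
    have "sin 0 - 0 / 3 \<le> sin x - x / 3"
    proof (rule DERIV_nonneg_imp_nondecreasing[OF x(1)])
      fix y assume y: "0 \<le> y" "y \<le> x"
      have "cos (pi / 3) \<le> cos y" using y True by (intro cos_monotone_0_pi_le) auto
      then have "0 \<le> cos y - 1 / 3" by (simp add: cos_60)
      moreover have "((\<lambda>y. sin y - y / 3) has_real_derivative cos y - 1 / 3) (at y)"
        by (auto intro!: derivative_eq_intros)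
      ultimately show "\<exists>d. ((\<lambda>y. sin y - y / 3) has_real_derivative d) (at y) \<and> 0 \<le> d" by blast
    qed
    then show ?thesis by simp
  next
    case False
    then have "sin (pi / 3) \<le> sin x" using x by (intro sin_monotone_2pi_le) auto
    moreover have "4 / 3 \<le> sqrt 3" by (rule real_le_rsqrt) (simp add: power2_eq_square)
    moreover have "x / 3 \<le> 4 / 6" using x(2) pi_less_4 by simp
    ultimately show ?thesis by (simp add: sin_60)
  qed
  show ?thesis
  proof (cases "x \<ge> 0")
    case True
    then show ?thesis using *[of x] assms by simp
  next
    case False
    then show ?thesis using *[of "- x"] assms by simp
  qed
qed

text \<open>With \<open>r\<close> the signed distance to the nearest integer, the chord has length
  \<open>2 * \<bar>sin (pi * r)\<bar>\<close>, at least \<open>2 * pi / 3\<close> times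
  \<open>\<bar>r\<bar>\<close>. Small divisors thus become distances to integers.\<close>

lemma norm_exp_2pi_minus_1_ge:
  fixes y :: real
  shows "\<exists>p::int. \<bar>y - of_int p\<bar> \<le> norm (exp (\<i> * of_real (2 * pi * y)) - 1)"
proof -
  define r where "r = y - of_int (round y)"
  have r: "\<bar>r\<bar> \<le> 1 / 2" using of_int_round_abs_le[of y] by (simp add: r_def abs_minus_commute)
  have "exp (\<i> * of_real (2 * pi * y)) = exp (\<i> * of_real (2 * pi * r))"
  proof -
    have "\<i> * of_real (2 * pi * y) = \<i> * of_real (2 * pi * r) + 2 * of_real pi * \<i> * of_int (round y)"
      by (simp add: r_def algebra_simps)
    moreover have "exp (2 * of_real pi * \<i> * of_int (round y)) = 1"
      using exp_integer_2pi[of "of_int (round y)"] by (simp add: mult_ac)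
    ultimately show ?thesis by (simp only: exp_add mult_1_right)
  qed
  also have "norm (exp (\<i> * of_real (2 * pi * r)) - 1) = 2 * \<bar>sin (pi * r)\<bar>"
    using dist_exp_i_1[of "2 * pi * r"] by simp
  finally have eq: "norm (exp (\<i> * of_real (2 * pi * y)) - 1) = 2 * \<bar>sin (pi * r)\<bar>" .
  have "\<bar>pi * r\<bar> / 3 \<le> \<bar>sin (pi * r)\<bar>"
    using r by (intro abs_sin_ge) (simp add: abs_mult)
  moreover have "2 * \<bar>r\<bar> \<le> pi * \<bar>r\<bar>" by (intro mult_right_mono pi_ge_two) auto
  ultimately have "\<bar>r\<bar> \<le> 2 * \<bar>sin (pi * r)\<bar>" by (simp add: abs_mult)
  then show ?thesis unfolding eq r_def by blast
qed

text \<open>Rounding \<open>\<alpha> * q\<close> down gives an approximation within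
  \<open>1 / q\<close> for every denominator. The bound makes \<open>\<nu> - 1\<close> positive,
  which fixes the direction of monotonicity of the powers used below.\<close>

lemma irrationality_measure_ge_1: "irrationality_measure \<alpha> \<ge> 1"
proof -
  let ?S = "{(p :: int, q :: nat). q > 0 \<and> \<bar>\<alpha> - of_int p / of_nat q\<bar> < of_nat q powr (- 1)}"
  have "(\<lambda>q. (\<lfloor>\<alpha> * of_nat q\<rfloor>, q)) ` {1..} \<subseteq> ?S"
  proof (rule image_subsetI)
    fix q :: nat assume "q \<in> {1..}"
    then have q: "real q > 0" by simp
    have "\<alpha> - of_int \<lfloor>\<alpha> * of_nat q\<rfloor> / of_nat q = (\<alpha> * of_nat q - of_int \<lfloor>\<alpha> * of_nat q\<rfloor>) / of_nat q"
      using q by (simp add: diff_divide_distrib)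
    moreover have "\<bar>\<alpha> * of_nat q - of_int \<lfloor>\<alpha> * of_nat q\<rfloor>\<bar> < 1" by linarith
    ultimately have "\<bar>\<alpha> - of_int \<lfloor>\<alpha> * of_nat q\<rfloor> / of_nat q\<bar> < of_nat q powr (- 1)"
      using q by (simp add: powr_minus_divide divide_strict_right_mono)
    then show "(\<lfloor>\<alpha> * of_nat q\<rfloor>, q) \<in> ?S" using q by simp
  qed
  moreover have "inj_on (\<lambda>q. (\<lfloor>\<alpha> * of_nat q\<rfloor>, q)) {1..}" by (auto simp: inj_on_def)
  then have "infinite ((\<lambda>q. (\<lfloor>\<alpha> * of_nat q\<rfloor>, q)) ` {1 :: nat..})"
    by (simp add: finite_image_iff infinite_Ici)
  ultimately have "infinite ?S" using finite_subset by blast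
  then show ?thesis unfolding irrationality_measure_def
    by (intro Sup_upper) (auto intro!: exI[of _ "1 :: real"] simp: one_ereal_def)
qed

text \<open>Inserting 1 before taking the minimum covers the empty set and yields
  \<open>c \<le> 1\<close>, which handles the fractions outside the exceptional set.\<close>

lemma finite_pos_lower_bound:
  fixes F :: "'a \<Rightarrow> real"
  assumes "finite S" "\<And>x. x \<in> S \<Longrightarrow> F x > 0"
  obtains c where "c > 0" "c \<le> 1" "\<And>x. x \<in> S \<Longrightarrow> c \<le> F x"
proof
  show "Min (insert 1 (F ` S)) > 0" using assms by (subst Min_gr_iff) auto
qed (use assms(1) in auto)

text \<open>For \<open>\<nu> > \<mu>\<close> only finitely many fractions approximate better than
  \<open>q powr (- \<nu>)\<close>, and by irrationality each of them misses \<open>\<alpha>\<close>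
  by a positive amount; shrinking the constant accommodates them.\<close>

lemma diophantine_lower_bound:
  assumes \<alpha>: "\<alpha> \<notin> \<rat>" and \<mu>: "irrationality_measure \<alpha> = ereal \<mu>" and \<nu>: "\<nu> > \<mu>"
  obtains c where "c > 0" "\<And>(p :: int) (q :: nat). q > 0 \<Longrightarrow> c * of_nat q powr (- \<nu>) \<le> \<bar>\<alpha> - of_int p / of_nat q\<bar>"
proof -
  let ?S = "{(p :: int, q :: nat). q > 0 \<and> \<bar>\<alpha> - of_int p / of_nat q\<bar> < of_nat q powr (- \<nu>)}"
  have "\<mu> \<ge> 1" using irrationality_measure_ge_1[of \<alpha>] \<mu> by (simp add: one_ereal_def)
  have fin: "finite ?S"
  proof (rule ccontr)
    assume "infinite ?S"
    then have "ereal \<nu> \<le> irrationality_measure \<alpha>"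
      unfolding irrationality_measure_def using \<nu> \<open>\<mu> \<ge> 1\<close> by (intro Sup_upper) auto
    then show False using \<mu> \<nu> by simp
  qed
  have pos: "\<bar>\<alpha> - of_int p / of_nat q\<bar> > 0" for p :: int and q :: nat
  proof -
    have "of_int p / of_nat q \<in> \<rat>" by (intro Rats_divide Rats_of_int Rats_of_nat)
    then show ?thesis using \<alpha> by auto
  qed
  let ?F = "\<lambda>(p :: int, q :: nat). \<bar>\<alpha> - of_int p / of_nat q\<bar> * of_nat q powr \<nu>"
  have "?F x > 0" if "x \<in> ?S" for x
    using that pos by (cases x) auto
  then obtain c where c: "c > 0" "c \<le> 1" "\<And>x. x \<in> ?S \<Longrightarrow> c \<le> ?F x"
    using finite_pos_lower_bound[OF fin, of ?F] by blast
  have "c * of_nat q powr (- \<nu>) \<le> \<bar>\<alpha> - of_int p / of_nat q\<bar>" if q: "q > 0" for p :: int and q :: nat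
  proof (cases "(p, q) \<in> ?S")
    case True
    then have "c \<le> \<bar>\<alpha> - of_int p / of_nat q\<bar> * of_nat q powr \<nu>" using c(3)[OF True] by simp
    then have "c * of_nat q powr (- \<nu>) \<le> \<bar>\<alpha> - of_int p / of_nat q\<bar> * of_nat q powr \<nu> * of_nat q powr (- \<nu>)"
      by (rule mult_right_mono) simp
    also have "\<dots> = \<bar>\<alpha> - of_int p / of_nat q\<bar>"
      using q by (simp add: mult.assoc flip: powr_add)
    finally show ?thesis .
  next
    case False
    then have "of_nat q powr (- \<nu>) \<le> \<bar>\<alpha> - of_int p / of_nat q\<bar>" using q by simp
    moreover have "c * of_nat q powr (- \<nu>) \<le> 1 * of_nat q powr (- \<nu>)"
      using c(2) by (rule mult_right_mono) simp
    ultimately show ?thesis by simp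
  qed
  with c(1) that show ?thesis by blast
qed

text \<open>Multiplying the Diophantine estimate by the denominator \<open>\<bar>snd q\<bar>\<close>
  improves the exponent from \<open>- \<nu>\<close> to \<open>1 - \<nu>\<close>.\<close>

lemma small_divisor_bound:
  assumes \<alpha>: "\<alpha> \<notin> \<rat>" and \<mu>: "irrationality_measure \<alpha> = ereal \<mu>" and \<nu>: "\<nu> > \<mu>"
  obtains c where "c > 0"
    "\<And>q. snd q \<noteq> 0 \<Longrightarrow> c * bracket q powr (1 - \<nu>) \<le> norm (exp (\<i> * of_real (2 * pi * \<alpha> * of_int (snd q))) - 1)"
proof -
  have "\<mu> \<ge> 1" using irrationality_measure_ge_1[of \<alpha>] \<mu> by (simp add: one_ereal_def)
  obtain c where c: "c > 0" "\<And>(p :: int) (q :: nat). q > 0 \<Longrightarrow> c * of_nat q powr (- \<nu>) \<le> \<bar>\<alpha> - of_int p / of_nat q\<bar>"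
    using diophantine_lower_bound[OF \<alpha> \<mu> \<nu>] by blast
  have "c * bracket q powr (1 - \<nu>) \<le> norm (exp (\<i> * of_real (2 * pi * \<alpha> * of_int (snd q))) - 1)"
    if q: "snd q \<noteq> 0" for q
  proof -
    define n where "n = nat \<bar>snd q\<bar>"
    have n: "n > 0" "real n = \<bar>of_int (snd q)\<bar>" using q by (auto simp: n_def)
    obtain p :: int where p: "\<bar>\<alpha> * of_int (snd q) - of_int p\<bar> \<le> norm (exp (\<i> * of_real (2 * pi * (\<alpha> * of_int (snd q)))) - 1)"
      using norm_exp_2pi_minus_1_ge by blast
    \<comment> \<open>Denominators are natural numbers, so a negative frequency is handled by
      changing the sign of \<open>p\<close>.\<close>
    have "\<exists>p' :: int. \<bar>\<alpha> * of_int (snd q) - of_int p\<bar> = \<bar>\<alpha> * real n - of_int p'\<bar>"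
    proof (cases "snd q \<ge> 0")
      case True
      then show ?thesis using n by (intro exI[of _ p]) simp
    next
      case False
      then show ?thesis using n by (intro exI[of _ "- p"]) (simp add: abs_if)
    qed
    then obtain p' :: int where p': "\<bar>\<alpha> * of_int (snd q) - of_int p\<bar> = \<bar>\<alpha> * real n - of_int p'\<bar>" ..
    \<comment> \<open>The exponent is negative, so replacing \<open>n\<close> by the larger
      \<open>bracket q\<close> weakens the lower bound.\<close>
    have "bracket q powr (1 - \<nu>) \<le> real n powr (1 - \<nu>)"
      using n bracket_ge(3)[of q] \<nu> \<open>\<mu> \<ge> 1\<close> by (intro powr_mono2') auto
    then have "c * bracket q powr (1 - \<nu>) \<le> c * real n powr (1 - \<nu>)"
      using c(1) by simp
    also have "\<dots> = real n * (c * real n powr (- \<nu>))"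
      using n(1) powr_add[of "real n" 1 "- \<nu>"] by simp
    also have "\<dots> \<le> real n * \<bar>\<alpha> - of_int p' / of_nat n\<bar>"
      using c(2)[OF n(1)] by (intro mult_left_mono) auto
    also have "\<dots> = \<bar>real n * (\<alpha> - of_int p' / of_nat n)\<bar>" by (simp add: abs_mult)
    also have "real n * (\<alpha> - of_int p' / of_nat n) = \<alpha> * real n - of_int p'"
      using n(1) by (simp add: right_diff_distrib mult.commute)
    also have "\<bar>\<alpha> * real n - of_int p'\<bar> \<le> norm (exp (\<i> * of_real (2 * pi * \<alpha> * of_int (snd q))) - 1)"
      using p p' by (simp only: mult.assoc)
    finally show ?thesis .
  qed
  with c(1) that show ?thesis by blast
qed

lemma transport_modes:
  assumes a: "smooth_circle a" and a0: "a0 = 1 / (2 * pi) * integral {0..2 * pi} a" "a0 \<notin> \<rat>"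
    and \<mu>: "irrationality_measure a0 = ereal \<mu>" and \<nu>: "\<nu> > \<mu>"
  obtains V where "\<And>q. q \<noteq> 0 \<Longrightarrow> V q \<in> test_fun"
    "\<And>q p. q \<noteq> 0 \<Longrightarrow> partial_t (V q) p - of_real (a (fst p)) * partial_x (V q) p = wave q p"
    "\<And>n. \<exists>D\<ge>0. \<forall>q. q \<noteq> 0 \<longrightarrow> Cbound n (bracket q) (D * bracket q powr (\<nu> - 1)) (V q)"
proof -
  obtain c where c: "c > 0" "\<And>q. snd q \<noteq> 0 \<Longrightarrow>
      c * bracket q powr (1 - \<nu>) \<le> norm (exp (\<i> * of_real (2 * pi * a0 * of_int (snd q))) - 1)"
    using small_divisor_bound[OF a0(2) \<mu> \<nu>] by blast
  \<comment> \<open>The maximum with 1 ensures \<open>M q \<ge> 1\<close>, required by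
    \<open>transport_mode_Cbound\<close> and sufficient for frequencies with
    \<open>snd q = 0\<close>.\<close>
  define K where "K = max 1 (6 * pi / c)"
  define M where "M q = K * bracket q powr (\<nu> - 1)" for q
  have "\<mu> \<ge> 1" using irrationality_measure_ge_1[of a0] \<mu> by (simp add: one_ereal_def)
  then have b1: "1 \<le> bracket q powr (\<nu> - 1)" for q
    using bracket_ge(1)[of q] \<nu> by (intro ge_one_powr_ge_zero) auto
  have M1: "M q \<ge> 1" for q
    using mult_mono[of 1 K 1 "bracket q powr (\<nu> - 1)"] b1[of q] by (simp add: M_def K_def)
  have ac: "continuous_on UNIV a" "\<And>t. a (t + 2 * pi) = a t"
    using a smooth_circle_has_deriv[OF a, of 0]
    by (auto simp: smooth_circle_def intro!: DERIV_isCont continuous_at_imp_continuous_on)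
  let ?h = "\<lambda>q t. exp (\<i> * of_real (t * of_int (fst q))) :: complex"
  have hp: "?h q (t + 2 * pi) = ?h q t" for q :: "int \<times> int" and t
    using periodic2_wave[of "(fst q, 0)"] by (simp add: periodic2_def wave_def)
  have "\<exists>E. (\<forall>t. (E has_vector_derivative \<i> * of_real (of_int (snd q) * a t) * E t + ?h q t) (at t)) \<and>
      (\<forall>t. E (t + 2 * pi) = E t) \<and> (\<forall>t. norm (E t) \<le> M q)" if q: "q \<noteq> 0" for q
  proof (cases "snd q = 0")
    case True
    then have \<tau>: "fst q \<noteq> 0" using q by (simp add: prod_eq_iff)
    \<comment> \<open>Here the equation is a plain integration without small divisor, and
      \<open>\<bar>fst q\<bar> \<ge> 1\<close> bounds the result by 1.\<close>
    let ?E = "\<lambda>t. inverse (\<i> * of_int (fst q)) * ?h q t"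
    have "((\<lambda>t. ?h q t) has_vector_derivative \<i> * of_int (fst q) * ?h q t) (at t)" for t
      using has_partial_t_wave[of "(fst q, 0)" 0 t] by (simp add: wave_def)
    from has_vector_derivative_mult_right[OF this, of "inverse (\<i> * of_int (fst q))"]
    have "(?E has_vector_derivative inverse (\<i> * of_int (fst q)) * (\<i> * of_int (fst q) * ?h q t)) (at t)" for t .
    moreover have "inverse (\<i> * of_int (fst q)) * (\<i> * of_int (fst q) * z) = z" for z :: complex
      using \<tau> by (simp add: field_simps)
    ultimately have "(?E has_vector_derivative ?h q t) (at t)" for t by simp
    moreover have "norm (?E t) \<le> M q" for t
    proof -
      have "norm (?h q t) = 1" by (rule norm_exp_i_times)
      then have "norm (?E t) = inverse \<bar>of_int (fst q)\<bar>"
        by (simp only: norm_mult norm_inverse norm_ii norm_of_int mult_1_left mult_1_right)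
      moreover have "1 \<le> \<bar>real_of_int (fst q)\<bar>" using \<tau> by linarith
      then have "inverse \<bar>real_of_int (fst q)\<bar> \<le> 1" by (rule inverse_le_1_iff[THEN iffD2, OF disjI2])
      ultimately have "norm (?E t) \<le> 1" by simp
      then show ?thesis using M1[of q] by linarith
    qed
    ultimately show ?thesis using True hp[of _ q] by (intro exI[of _ ?E]) auto
  next
    case False
    note cq = c(2)[OF False]
    have pos: "c * bracket q powr (1 - \<nu>) > 0" using c(1) bracket_ge(1)[of q] by simp
    then have ne: "exp (\<i> * of_real (2 * pi * a0 * of_int (snd q))) \<noteq> 1" using cq by auto
    have hc: "continuous_on UNIV (?h q)" by (intro continuous_intros)
    have h1: "norm (?h q t) \<le> 1" for t by (simp only: norm_exp_i_times order_refl)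
    obtain E where E: "\<And>t. (E has_vector_derivative \<i> * of_real (of_int (snd q) * a t) * E t + ?h q t) (at t)"
      "\<And>t. E (t + 2 * pi) = E t"
      "\<And>t. norm (E t) \<le> 6 * pi / norm (exp (\<i> * of_real (2 * pi * a0 * of_int (snd q))) - 1)"
      using periodic_transport_ode[OF ac a0(1) hc _ h1 ne] hp by blast
    have "norm (E t) \<le> M q" for t
    proof -
      have "norm (E t) \<le> 6 * pi / (c * bracket q powr (1 - \<nu>))"
        by (rule order_trans[OF E(3) divide_left_mono[OF cq _ mult_pos_pos[OF less_le_trans[OF pos cq] pos]]]) simp
      also have "\<dots> = 6 * pi / c * bracket q powr (\<nu> - 1)"
        using powr_minus[of "bracket q" "\<nu> - 1"] by (simp add: field_simps)
      also have "\<dots> \<le> M q" unfolding M_def K_def by (intro mult_right_mono) auto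
      finally show ?thesis .
    qed
    with E(1,2) show ?thesis by blast
  qed
  then obtain E where E: "\<And>q t. q \<noteq> 0 \<Longrightarrow> (E q has_vector_derivative \<i> * of_real (of_int (snd q) * a t) * E q t + ?h q t) (at t)"
    "\<And>q t. q \<noteq> 0 \<Longrightarrow> E q (t + 2 * pi) = E q t" "\<And>q t. q \<noteq> 0 \<Longrightarrow> norm (E q t) \<le> M q"
    by metis
  define V where "V q p = E q (fst p) * wave (0, snd q) p" for q p
  have V: "V q = (\<lambda>p. E q (fst p) * wave (0, snd q) p)" for q by (simp add: V_def fun_eq_iff)
  have bound: "\<exists>D\<ge>0. \<forall>q. q \<noteq> 0 \<longrightarrow> Cbound n (bracket q) (D * bracket q powr (\<nu> - 1)) (V q)" for n
  proof -
    obtain D where D: "D \<ge> 1" "\<And>q E M.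
     (\<forall>t. (E has_vector_derivative \<i> * of_real (of_int (snd q) * a t) * E t + ?h q t) (at t)) \<Longrightarrow>
     (\<forall>t. norm (E t) \<le> M) \<Longrightarrow> M \<ge> 1 \<Longrightarrow>
     Cbound n (bracket q) (D * M) (\<lambda>p. E (fst p) * wave (0, snd q) p)"
      using transport_mode_Cbound[OF a, of n] by blast
    have "Cbound n (bracket q) (D * K * bracket q powr (\<nu> - 1)) (V q)" if "q \<noteq> 0" for q
      using D(2)[of "E q" q "M q"] E(1,3) M1 that unfolding V by (simp add: M_def mult.assoc)
    moreover have "D * K \<ge> 0" using D(1) by (simp add: K_def)
    ultimately show ?thesis by blast
  qed
  show ?thesis
  proof (rule that[of V])
    fix q :: "int \<times> int" assume q: "q \<noteq> 0"
    note D = transport_mode_has_partials[of "E q" q a, OF E(1)[OF q]]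
    have "periodic2 (V q)"
      unfolding V periodic2_def using periodic2_wave[of "(0, snd q)"] E(2)[OF q]
      by (simp add: periodic2_def)
    moreover have "C_diff n (V q)" for n
      using bound[of n] q Cbound_imp_C_diff by blast
    ultimately show "V q \<in> test_fun" by (simp add: test_fun_def)
    show "partial_t (V q) p - of_real (a (fst p)) * partial_x (V q) p = wave q p" for p
    proof -
      obtain t x where p: "p = (t, x)" by force
      show ?thesis
        using D(1)[of x t] D(2)[of t x] by (simp add: p V partial_t_def partial_x_def vector_derivative_at)
    qed
  qed (rule bound)
qed

section \<open>Summation over the frequencies\<close>

lemma summable_on_int_even:
  fixes h :: "int \<Rightarrow> real"
  assumes nonneg: "\<And>n. h n \<ge> 0" and even: "\<And>n. h (- n) = h n" and sum: "summable (\<lambda>n. h (int n))"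
  shows "h summable_on UNIV"
proof -
  have "(\<lambda>n. h (int n)) summable_on UNIV"
    using sum nonneg by (simp add: summable_on_UNIV_nonneg_real_iff)
  then have "h summable_on range int"
    by (subst summable_on_reindex) (auto simp: o_def)
  moreover have "(\<lambda>n. h (- int (Suc n))) summable_on UNIV"
    using summable_Suc_iff[of "\<lambda>n. h (int n)"] sum nonneg
    by (simp add: summable_on_UNIV_nonneg_real_iff even del: of_nat_Suc)
  then have "h summable_on range (\<lambda>n. - int (Suc n))"
    by (subst summable_on_reindex) (auto simp: o_def inj_on_def)
  ultimately have "h summable_on range int \<union> range (\<lambda>n. - int (Suc n))"
    by (rule summable_on_Un_disjoint) auto
  moreover have "z \<in> range int \<union> range (\<lambda>n. - int (Suc n))" for z
    by (cases z rule: int_cases) auto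
  then have "range int \<union> range (\<lambda>n. - int (Suc n)) = UNIV" by blast
  ultimately show ?thesis by simp
qed

lemma power2_powr:
  fixes x z :: real
  assumes "x > 0"
  shows "(x\<^sup>2) powr z = x powr (2 * z)"
proof -
  have "x\<^sup>2 = x powr 2" using assms by simp
  then show ?thesis by (simp only: powr_powr)
qed

text \<open>From \<open>(1 + x) * (1 + y) \<le> (1 + x + y)\<^sup>2\<close> the weight is dominated
  by a product of one-variable weights, each decaying like \<open>\<bar>n\<bar> powr (- s)\<close>;
  this explains the threshold 1.\<close>

lemma summable_on_bracket:
  assumes s: "s > 1"
  shows "(\<lambda>q. bracket q powr (- 2 * s)) summable_on UNIV"
proof -
  define h where "h n = (1 + (real_of_int n)\<^sup>2) powr (- s / 2)" for n
  have h0: "h n \<ge> 0" for n by (simp add: h_def)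
  have "summable (\<lambda>n. h (int n))"
  proof (rule summable_comparison_test[OF exI[of _ 1]])
    show "summable (\<lambda>n. real n powr (- s))" using s by (simp add: summable_real_powr_iff)
    show "\<forall>n\<ge>1. norm (h (int n)) \<le> real n powr (- s)"
    proof safe
      fix n :: nat assume n: "1 \<le> n"
      have "h (int n) \<le> ((real n)\<^sup>2) powr (- s / 2)"
        unfolding h_def using n s by (intro powr_mono2') auto
      also have "\<dots> = real n powr (- s)"
        using power2_powr[of "real n" "- s / 2"] n by simp
      finally show "norm (h (int n)) \<le> real n powr (- s)" using h0[of "int n"] by simp
    qed
  qed
  then have h: "h summable_on UNIV"
    using h0 by (intro summable_on_int_even) (auto simp: h_def)
  have hh: "(\<lambda>(x, y). h x * h y) summable_on UNIV \<times> UNIV"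
  proof (rule summable_on_SigmaI)
    show "((\<lambda>y. case (x, y) of (x, y) \<Rightarrow> h x * h y) has_sum h x * infsum h UNIV) UNIV" for x
      using has_sum_cmult_right[OF has_sum_infsum[OF h], of "h x"] by simp
    show "(\<lambda>x. h x * infsum h UNIV) summable_on UNIV" by (rule summable_on_cmult_left[OF h])
  qed (use h0 in auto)
  show ?thesis
  proof (rule summable_on_comparison_test)
    show "(\<lambda>q. h (fst q) * h (snd q)) summable_on UNIV" using hh by (simp add: case_prod_unfold)
    show "bracket q powr (- 2 * s) \<le> h (fst q) * h (snd q)" for q
    proof -
      let ?x = "(real_of_int (fst q))\<^sup>2" and ?y = "(real_of_int (snd q))\<^sup>2"
      have b2: "(bracket q)\<^sup>2 = 1 + ?x + ?y" by (simp add: bracket_eq)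
      have "bracket q powr (- 2 * s) = ((bracket q)\<^sup>2 * (bracket q)\<^sup>2) powr (- s / 2)"
        using power2_powr[of "bracket q" "- s / 2"] power2_powr[of "(bracket q)\<^sup>2" "- s / 2"] bracket_ge(1)[of q]
          power2_powr[of "bracket q" "- s"]
        by (simp flip: power2_eq_square)
      also have "\<dots> \<le> ((1 + ?x) * (1 + ?y)) powr (- s / 2)"
      proof (rule powr_mono2')
        show "(1 + ?x) * (1 + ?y) \<le> (bracket q)\<^sup>2 * (bracket q)\<^sup>2"
          unfolding b2 by (intro mult_mono) auto
        show "0 < (1 + ?x) * (1 + ?y)" by (intro mult_pos_pos add_pos_nonneg) auto
      qed (use s in auto)
      also have "\<dots> = h (fst q) * h (snd q)"
        unfolding h_def by (rule powr_mult)
      finally show ?thesis .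
    qed
  qed auto
qed

text \<open>Cauchy-Schwarz in the pointwise form \<open>x * y \<le> x\<^sup>2 + y\<^sup>2\<close>,
  splitting the weight as \<open>bracket q powr k\<close> times
  \<open>bracket q powr (r - k)\<close>.\<close>

lemma sobolev_weighted_summable:
  assumes f: "f \<in> sobolev k" and r: "r + 1 < k"
  shows "(\<lambda>q. norm (fourier_coeff f (fst q) (snd q)) * bracket q powr r) summable_on UNIV"
proof -
  let ?c = "\<lambda>q. norm (fourier_coeff f (fst q) (snd q))"
  have "(\<lambda>q. bracket q powr (2 * k) * (?c q)\<^sup>2) summable_on UNIV"
    using f by (simp add: sobolev_def bracket_def case_prod_unfold)
  moreover have "(\<lambda>q. bracket q powr (- 2 * (k - r))) summable_on UNIV"
    using r by (intro summable_on_bracket) auto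
  ultimately have "(\<lambda>q. bracket q powr (2 * k) * (?c q)\<^sup>2 + bracket q powr (- 2 * (k - r))) summable_on UNIV"
    by (rule summable_on_add)
  then show ?thesis
  proof (rule summable_on_comparison_test)
    fix q :: "int \<times> int"
    let ?x = "?c q * bracket q powr k" and ?y = "bracket q powr (r - k)"
    have b: "bracket q > 0" using bracket_ge(1)[of q] by simp
    have "?c q * bracket q powr r = ?x * ?y"
      by (simp add: mult.assoc flip: powr_add)
    also have "\<dots> \<le> ?x\<^sup>2 + ?y\<^sup>2"
    proof -
      have "0 \<le> ?x * ?y" by (intro mult_nonneg_nonneg) auto
      moreover have "2 * (?x * ?y) \<le> ?x\<^sup>2 + ?y\<^sup>2"
        using sum_squares_bound[of ?x ?y] by (simp only: mult.assoc)
      ultimately show ?thesis by linarith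
    qed
    also have "\<dots> = bracket q powr (2 * k) * (?c q)\<^sup>2 + bracket q powr (- 2 * (k - r))"
    proof -
      have "(bracket q powr z)\<^sup>2 = bracket q powr (2 * z)" for z
        unfolding power2_eq_square mult_2 powr_add ..
      then show ?thesis by (simp add: power_mult_distrib mult.commute)
    qed
    finally show "?c q * bracket q powr r \<le> bracket q powr (2 * k) * (?c q)\<^sup>2 + bracket q powr (- 2 * (k - r))" .
  qed auto
qed

section \<open>Regularity of solutions\<close>

lemma dist_of_fun_cmult: "dist_of_fun (\<lambda>p. c * g p) \<phi> = c * dist_of_fun g \<phi>"
  by (simp add: dist_of_fun_def mult.assoc)

text \<open>A nonzero component \<open>n\<close> of the frequency makes \<open>\<i> * n\<close>
  times the integral the integral of a derivative over a period, hence zero.\<close>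

lemma integral_wave: "integral torus_box (wave q) = (if q = 0 then of_real ((2 * pi)\<^sup>2) else 0)"
proof (cases "q = 0")
  case True
  then have "wave q = (\<lambda>p. 1)" by auto
  then show ?thesis
    using True by (simp add: content_torus_box scaleR_conv_of_real)
next
  case False
  have c: "continuous_on UNIV (\<lambda>p. \<i> * of_int n * wave q p)" for n
    by (intro continuous_intros continuous_wave)
  have "integral torus_box (\<lambda>p. \<i> * of_int (fst q) * wave q p) = 0"
    by (rule integral_partial_t_periodic[OF has_partial_t_wave c periodic2_wave])
  moreover have "integral torus_box (\<lambda>p. \<i> * of_int (snd q) * wave q p) = 0"
    by (rule integral_partial_x_periodic[OF has_partial_x_wave c periodic2_wave])
  ultimately show ?thesis using False by (auto simp: prod_eq_iff)
qed

lemma dist_of_fun_wave_wave: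
  "dist_of_fun (wave q) (wave r) = (if q = - r then of_real ((2 * pi)\<^sup>2) else 0)"
  using integral_wave[of "q + r"]
  by (simp add: dist_of_fun_def wave_add[symmetric] eq_neg_iff_add_eq_0)

text \<open>The transposed operator reproduces the original one up to sign, because \<open>a\<close>
  commutes with \<open>partial_x\<close>. Writing \<open>a * partial_x W\<close> as
  \<open>partial_t W - w\<close> exhibits it as a difference of test functions, to which linearity
  of \<open>u\<close> applies.\<close>

lemma L_op_eq:
  assumes u: "distribution u" and W: "W \<in> test_fun" and w: "w \<in> test_fun"
    and eq: "\<And>p. partial_t W p - of_real (a (fst p)) * partial_x W p = w p"
  shows "L_op a u W = - u w"
proof -
  have "partial_x (\<lambda>(t, x). of_real (a t) * W (t, x)) = (\<lambda>p. of_real (a (fst p)) * partial_x W p)"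
    by (rule partial_x_eqI) (auto intro!: has_vector_derivative_mult_right test_fun_has_partial_x W)
  also have "\<dots> = (\<lambda>p. partial_t W p - w p)" using eq by (auto simp: fun_eq_iff algebra_simps)
  finally have "L_op a u W = - u (partial_t W) + u (\<lambda>p. partial_t W p - w p)"
    by (simp add: L_op_def dist_partial_t_def dist_mult_t_def dist_partial_x_def)
  then show ?thesis by (simp add: distribution_diff[OF u test_fun_partial_t[OF W] w])
qed

text \<open>For \<open>m \<ge> 1\<close> the ceiling gives \<open>3 * m < k - \<mu> + 1/2\<close>,
  and \<open>2 * m > 1/2\<close>; for \<open>m = 0\<close> the claim is \<open>k > \<mu>\<close>.
  The truncation by \<open>nat\<close> is harmless as the ceiling is at least 1.\<close>

lemma regularity_order_less:
  fixes k \<mu> :: real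
  assumes "k > \<mu>" "m = nat (\<lceil>(k - \<mu> + 1 / 2) / 3\<rceil> - 1)"
  shows "real m < k - \<mu>"
proof (cases "m = 0")
  case False
  have "\<lceil>(k - \<mu> + 1 / 2) / 3\<rceil> \<ge> 1" using assms(1) by simp
  then have "real m = of_int \<lceil>(k - \<mu> + 1 / 2) / 3\<rceil> - 1" using assms(2) by simp
  then have "real m < (k - \<mu> + 1 / 2) / 3" by linarith
  moreover have "real m \<ge> 1" using False by simp
  ultimately show ?thesis by simp
qed (use assms(1) in simp)

theorem corollary5p7:
  fixes a :: "real \<Rightarrow> real" and a0 \<mu> k :: real and m :: nat
    and u f :: "(real \<times> real \<Rightarrow> complex) \<Rightarrow> complex"
  assumes "smooth_circle a"
    and "a0 = 1 / (2 * pi) * integral {0..2 * pi} a"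
    and "a0 \<notin> \<rat>"
    and "irrationality_measure a0 = ereal \<mu>"
    and "k > \<mu>"
    and "distribution u"
    and "f \<in> sobolev k"
    and "dist_eq (L_op a u) f"
    and "m = nat (\<lceil>(k - \<mu> + 1 / 2) / 3\<rceil> - 1)"
  shows "dist_in_Cm m u"
proof -
  note a = assms(1) and \<mu> = assms(4) and u = assms(6) and f = assms(7)
  have fd: "distribution f" using f by (simp add: sobolev_def)
  have Lu: "L_op a u \<phi> = f \<phi>" if "\<phi> \<in> test_fun" for \<phi>
    using assms(8) that by (simp add: dist_eq_def)
  have m: "real m < k - \<mu>" by (rule regularity_order_less[OF assms(5,9)])
  \<comment> \<open>The midpoint leaves room on both sides: above \<open>\<mu>\<close> for the small
    divisors, below \<open>k - m\<close> for the summation.\<close>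
  define \<nu> where "\<nu> = (\<mu> + (k - m)) / 2"
  have \<nu>: "\<mu> < \<nu>" "\<nu> < k - m" using m by (simp_all add: \<nu>_def)
  have "\<mu> \<ge> 1" using irrationality_measure_ge_1[of a0] \<mu> by (simp add: one_ereal_def)
  define \<gamma> where "\<gamma> = \<nu> - 1"
  have \<gamma>: "\<gamma> \<ge> 0" "\<gamma> + m + 1 < k" using \<nu> \<open>\<mu> \<ge> 1\<close> by (simp_all add: \<gamma>_def)
  obtain V where V: "\<And>q. q \<noteq> 0 \<Longrightarrow> V q \<in> test_fun"
    "\<And>q p. q \<noteq> 0 \<Longrightarrow> partial_t (V q) p - of_real (a (fst p)) * partial_x (V q) p = wave q p"
    "\<And>n. \<exists>D\<ge>0. \<forall>q. q \<noteq> 0 \<longrightarrow> Cbound n (bracket q) (D * bracket q powr \<gamma>) (V q)"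
    using transport_modes[OF a assms(2,3) \<mu> \<nu>(1)] unfolding \<gamma>_def by blast
  define c where "c q = fourier_coeff f (fst q) (snd q)" for q
  have fw: "f (wave (- q)) = of_real ((2 * pi)\<^sup>2) * c q" for q
    by (simp add: c_def fourier_coeff_eq_wave uminus_prod_def)
  \<comment> \<open>Compatibility condition, obtained by testing the equation on the constant 1,
    which the operator annihilates.\<close>
  have c0: "c 0 = 0"
  proof -
    have "L_op a u (wave 0) = - u (\<lambda>p. 0 * wave 0 p)"
      by (rule L_op_eq[OF u test_fun_wave test_fun_cmult[OF test_fun_wave]]) (simp add: partial_wave)
    also have "\<dots> = 0" by (simp only: distribution_cmult[OF u test_fun_wave]) simp
    finally show ?thesis using Lu[OF test_fun_wave[of 0]] fw[of 0] by simp
  qed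
  have "infinite (UNIV :: (int \<times> int) set)" by (simp add: finite_prod)
  then obtain e :: "nat \<Rightarrow> int \<times> int" where e: "bij_betw e UNIV UNIV"
    using bij_betw_from_nat_into[of "UNIV :: (int \<times> int) set"] by blast
  have S: "summable (\<lambda>i. norm (c (e i)) * bracket (e i) powr r)" if "r + 1 < k" for r
  proof -
    have "(\<lambda>i. norm (c (e i)) * bracket (e i) powr r) summable_on UNIV"
      using sobolev_weighted_summable[OF f that]
        summable_on_reindex_bij_betw[OF e, of "\<lambda>q. norm (c q) * bracket q powr r"] by (simp add: c_def)
    then show ?thesis by (rule summable_on_imp_summable)
  qed
  have S0: "summable (\<lambda>i. norm (c (e i)))"
    using S[of 0] \<gamma> by (simp add: bracket_ge(1)[THEN less_le_trans[OF zero_less_one], THEN less_imp_neq, symmetric])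
  have S\<gamma>: "summable (\<lambda>i. norm (c (e i)) * bracket (e i) powr \<gamma>)"
    using \<gamma> by (intro S) simp
  \<comment> \<open>The Fourier series of \<open>f\<close> converges absolutely since
    \<open>k > 1\<close>, so \<open>f\<close> is a continuous function and can be expanded term by
    term against any test function.\<close>
  define F where "F = (\<lambda>p. \<Sum>i. c (e i) * wave (e i) p)"
  \<comment> \<open>\<open>V 0\<close> is unconstrained; the value 0 put in its place is consistent
    with \<open>c 0 = 0\<close>.\<close>
  define V' where "V' q = (\<lambda>p. c q * (if q = 0 then 0 else V q p))" for q
  define g where "g = (\<lambda>p. \<Sum>i. V' (e i) p)"
  have Fc: "continuous_on UNIV (\<lambda>p. c (e i) * wave (e i) p)" for i
    by (intro continuous_intros continuous_wave)
  have Fn: "norm (c (e i) * wave (e i) p) \<le> norm (c (e i))" for i p by (simp add: norm_mult)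
  have F: "continuous_on UNIV F" unfolding F_def by (rule continuous_on_series[OF Fc Fn S0])
  have Fp: "periodic2 F" unfolding F_def periodic2_def using periodic2_wave by (simp add: periodic2_def)
  note Fsums = dist_of_fun_sums[OF Fc Fn S0, folded F_def]
  have fF: "f \<phi> = dist_of_fun F \<phi>" if "\<phi> \<in> test_fun" for \<phi>
  proof -
    have "f (wave r) = dist_of_fun F (wave r)" for r
    proof -
      obtain i0 where i0: "e i0 = - r" using e by (metis bij_betw_def UNIV_I imageE)
      have "e i \<noteq> - r" if "i \<noteq> i0" for i
        using e i0 that by (metis bij_betw_def injD)
      then have "(\<lambda>i. dist_of_fun (\<lambda>p. c (e i) * wave (e i) p) (wave r)) =
          (\<lambda>i. if i = i0 then c (- r) * of_real ((2 * pi)\<^sup>2) else 0)"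
        using i0 by (intro ext) (simp add: dist_of_fun_cmult dist_of_fun_wave_wave)
      with Fsums[OF continuous_wave, of r]
      have "(\<lambda>i. if i = i0 then c (- r) * of_real ((2 * pi)\<^sup>2) else 0) sums dist_of_fun F (wave r)" by simp
      from sums_unique2[OF this sums_single[of i0 "\<lambda>i. c (- r) * of_real ((2 * pi)\<^sup>2)"]]
      show ?thesis using fw[of "- r"] by (simp add: mult.commute)
    qed
    from distribution_eqI[OF fd distribution_dist_of_fun[OF Fp F] this] show ?thesis
      using that by (simp add: dist_eq_def)
  qed
  have V'b: "\<exists>D\<ge>0. \<forall>q. Cbound n (bracket q) (D * (norm (c q) * bracket q powr \<gamma>)) (V' q)" for n
  proof -
    obtain D where D: "D \<ge> 0" "\<And>q. q \<noteq> 0 \<Longrightarrow> Cbound n (bracket q) (D * bracket q powr \<gamma>) (V q)"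
      using V(3)[of n] by blast
    have "Cbound n (bracket q) (D * (norm (c q) * bracket q powr \<gamma>)) (V' q)" for q
    proof (cases "q = 0")
      case True
      then have "V' q = (\<lambda>p. 0)" by (simp add: V'_def)
      then show ?thesis using D(1) bracket_ge(1)[of q] by (simp add: Cbound_zero)
    next
      case False
      then have "V' q = (\<lambda>p. c q * V q p)" by (simp add: V'_def)
      then show ?thesis using Cbound_cmult[OF D(2)[OF False], of "c q"] by (simp add: mult_ac)
    qed
    with D(1) show ?thesis by blast
  qed
  obtain D0 where D0: "\<And>q. Cbound 0 (bracket q) (D0 * (norm (c q) * bracket q powr \<gamma>)) (V' q)"
    using V'b[of 0] by blast
  have V'c: "continuous_on UNIV (V' (e i))" for i using D0[of "e i"] by simp
  have V'n: "norm (V' (e i) p) \<le> D0 * (norm (c (e i)) * bracket (e i) powr \<gamma>)" for i p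
    using D0[of "e i"] by (cases p) simp
  note gsums = dist_of_fun_sums[OF V'c V'n summable_mult[OF S\<gamma>], folded g_def]
  have gp: "periodic2 g"
  proof -
    have "periodic2 (V' q)" for q
      using V(1)[of q] by (auto simp: V'_def periodic2_def dest!: test_fun_periodic2)
    then show ?thesis by (simp add: g_def periodic2_def)
  qed
  have gC: "C_diff m g"
  proof -
    obtain D where D: "\<And>q. Cbound m (bracket q) (D * (norm (c q) * bracket q powr \<gamma>)) (V' q)"
      using V'b[of m] by blast
    have "D * (norm (c q) * bracket q powr \<gamma>) * bracket q ^ m = D * (norm (c q) * bracket q powr (\<gamma> + m))" for q
      using bracket_ge(1)[of q] by (simp add: powr_add powr_realpow)
    then have "summable (\<lambda>i. D * (norm (c (e i)) * bracket (e i) powr \<gamma>) * bracket (e i) ^ m)"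
      using summable_mult[OF S[OF \<gamma>(2)], of D] by (simp only:)
    then show ?thesis unfolding g_def by (intro C_diff_series[OF D]) (auto intro: bracket_ge)
  qed
  \<comment> \<open>Both sides are compared through \<open>dist_of_fun F (V r)\<close>: the equation
    makes it \<open>- u (wave r)\<close>, and moving the operator from \<open>V r\<close> onto each
    term of \<open>F\<close> makes it \<open>- dist_of_fun g (wave r)\<close>. The pairing is
    bilinear without conjugation, so the same \<open>r\<close> appears on both sides.\<close>
  have ug: "u (wave r) = dist_of_fun g (wave r)" if r: "r \<noteq> 0" for r
  proof -
    have a': "continuous_on UNIV a" "\<And>t. a (t + 2 * pi) = a t"
      using a smooth_circle_has_deriv[OF a, of 0]
      by (auto simp: smooth_circle_def intro!: DERIV_isCont continuous_at_imp_continuous_on)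
    have "- u (wave r) = L_op a u (V r)"
      by (rule L_op_eq[OF u V(1)[OF r] test_fun_wave V(2)[OF r], symmetric])
    also have "\<dots> = dist_of_fun F (V r)" using Lu fF V(1)[OF r] by simp
    finally have "- u (wave r) = dist_of_fun F (V r)" .
    moreover have "dist_of_fun (\<lambda>p. c q * wave q p) (V r) = - dist_of_fun (V' q) (wave r)" for q
    proof (cases "q = 0")
      case True
      then show ?thesis by (simp add: V'_def c0 dist_of_fun_def)
    next
      case False
      have "dist_of_fun (wave q) (V r) = - dist_of_fun (V q) (wave r)"
        by (rule dist_of_fun_transport_adjoint[OF a' V(1)[OF False] V(1)[OF r] V(2)[OF False] V(2)[OF r]])
      then show ?thesis using False by (simp add: V'_def dist_of_fun_cmult)
    qed
    then have "(\<lambda>i. - dist_of_fun (V' (e i)) (wave r)) sums dist_of_fun F (V r)"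
      using Fsums[OF test_fun_continuous[OF V(1)[OF r]]] by simp
    from sums_unique2[OF this sums_minus[OF gsums[OF continuous_wave]]]
    have "dist_of_fun F (V r) = - dist_of_fun g (wave r)" .
    ultimately show ?thesis by simp
  qed
  \<comment> \<open>The constant that corrects the mean of \<open>g\<close>;
    \<open>(2 * pi)\<^sup>2\<close> is the area of the torus. Keeping the factor
    \<open>wave 0\<close> lets orthogonality show that the other coefficients are unchanged.\<close>
  define \<kappa> where "\<kappa> = (u (wave 0) - dist_of_fun g (wave 0)) / of_real ((2 * pi)\<^sup>2)"
  let ?G = "\<lambda>p. g p + \<kappa> * wave 0 p"
  have GC: "C_diff m ?G" by (intro C_diff_add gC C_diff_cmult test_fun_C_diff test_fun_wave)
  have Gp: "periodic2 ?G" using gp by (simp add: periodic2_def)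
  have "u (wave r) = dist_of_fun ?G (wave r)" for r
  proof -
    have "dist_of_fun ?G (wave r) = dist_of_fun g (wave r) + dist_of_fun (\<lambda>p. \<kappa> * wave 0 p) (wave r)"
      unfolding dist_of_fun_def distrib_right
      by (intro integral_add integrable_torus_box continuous_intros continuous_wave C_diff_imp_continuous[OF gC])
    also have "dist_of_fun (\<lambda>p. \<kappa> * wave 0 p) (wave r) = (if r = 0 then u (wave 0) - dist_of_fun g (wave 0) else 0)"
      unfolding dist_of_fun_cmult dist_of_fun_wave_wave by (auto simp: \<kappa>_def)
    finally show ?thesis using ug[of r] by (cases "r = 0") (simp_all del: wave_0)
  qed
  from distribution_eqI[OF u distribution_dist_of_fun[OF Gp C_diff_imp_continuous[OF GC]] this]
  show ?thesis unfolding dist_in_Cm_def Cm_torus_def using Gp GC by blast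
qed

end
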